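(* Let $\gamma(z)$ be an invertible $n\times n$ matrix-valued function on $S^1$ which extends analytically to a neighbourhood of $S^1$. Define, for $\psi\in H^{(n)}_+$, $$[\tilde{\mathcal P}_\gamma\psi](z):=\mathrm{pr}_+\left(\psi(z)+\frac1{2\pi i}\oint_{S^1}\frac{\gamma(z)\gamma^{-1}(\zeta)-I}{\zeta-z}\,\psi(\zeta)\,d\zeta\right).$$ Then $\tilde{\mathcal P}_\gamma=\mathcal P_\gamma$, where $\mathcal P_\gamma=T(\gamma)T(\gamma^{-1})$.
   Context: $H^{(n)}=L^2(S^1,\mathbb C^n)$; $H^{(n)}_+$ is the closed subspace of functions with only nonnegative Fourier modes, and $\mathrm{pr}_+$ is the orthogonal projection onto it. For a matrix loop $\gamma(z)=\sum_k\gamma^{(k)}z^k$, $T(\gamma):=\mathrm{pr}_+\circ\gamma:H_+^{(n)}\to H_+^{(n)}$ is the block Toeplitz operator with matrix $(\gamma^{(i-j)})_{i,j\ge0}$. In blocks, $\mathcal P_\gamma=\big[\delta_i^j I-\sum_{k\ge1}\gamma^{(i+k)}(\gamma^{-1})^{(-j-k)}\big]_{i,j\ge0}$. *)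

theory Defs
  imports "HOL-Complex_Analysis.Complex_Analysis" "HOL-Probability.Probability"
begin

text \<open>
  Normalised arc length on the unit circle. Its underlying space is the circle itself, so
  measurability, integrals and almost-everywhere statements see functions on
  \<^typ>\<open>complex\<close> only through their values on the circle.
\<close>

definition circle_measure :: "complex measure" where
  "circle_measure =
     distr (uniform_measure lborel {0..2 * pi}) (restrict_space borel (sphere 0 1)) cis"

lemma space_circle_measure [simp]: "space circle_measure = sphere 0 1"
  by (simp add: circle_measure_def space_restrict_space)

text \<open>In particular \<^const>\<open>cis\<close> is measurable here, so the image measure is not degenerate.\<close>

lemma prob_space_circle_measure: "prob_space circle_measure"
proof -
  have "emeasure lborel {0..2 * pi} = ennreal (2 * pi)"
    by simp
  then have "prob_space (uniform_measure lborel {0..2 * pi})"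
    by (intro prob_space_uniform_measure) auto
  moreover have "cis \<in> uniform_measure lborel {0..2 * pi} \<rightarrow>\<^sub>M restrict_space borel (sphere 0 1)"
  proof (rule measurable_restrict_space2)
    have "cis \<in> borel_measurable (borel :: real measure)"
      by (intro borel_measurable_continuous_onI continuous_intros)
    then show "cis \<in> borel_measurable (uniform_measure lborel {0..2 * pi})"
      by simp
  qed auto
  ultimately show ?thesis
    unfolding circle_measure_def by (rule prob_space.prob_space_distr)
qed

text \<open>
  Elements of $L^2(S^1, C^n)$ are represented by functions, and two of them are
  identified when they agree almost everywhere with respect to \<^const>\<open>circle_measure\<close>.
\<close>

definition L2_circle :: "(complex \<Rightarrow> complex ^ 'n) set" where
  "L2_circle = {f. f \<in> borel_measurable circle_measure \<and>
                   integrable circle_measure (\<lambda>z. (norm (f z))\<^sup>2)}"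

definition L2_inner :: "(complex \<Rightarrow> complex ^ 'n) \<Rightarrow> (complex \<Rightarrow> complex ^ 'n) \<Rightarrow> complex" where
  "L2_inner f g = (LINT z|circle_measure. (\<Sum>i\<in>UNIV. f z $ i * cnj (g z $ i)))"

definition fourier_coeff :: "(complex \<Rightarrow> complex ^ 'n) \<Rightarrow> int \<Rightarrow> complex ^ 'n" where
  "fourier_coeff f k = (LINT z|circle_measure. (z powi (- k)) *s f z)"

definition H_plus :: "(complex \<Rightarrow> complex ^ 'n) set" where
  "H_plus = {f \<in> L2_circle. \<forall>k<0. fourier_coeff f k = 0}"

text \<open>
  The orthogonal projection is determined only up to equality almost everywhere; the choice
  operator selects a representative. The selected function depends only on the class of the
  argument, since the defining condition does.
\<close>

definition pr_plus :: "(complex \<Rightarrow> complex ^ 'n) \<Rightarrow> complex \<Rightarrow> complex ^ 'n" where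
  "pr_plus f = (SOME g. g \<in> H_plus \<and> (\<forall>h\<in>H_plus. L2_inner (\<lambda>z. f z - g z) h = 0))"

definition toeplitz ::
    "(complex \<Rightarrow> complex ^ 'n ^ 'n) \<Rightarrow> (complex \<Rightarrow> complex ^ 'n) \<Rightarrow> complex \<Rightarrow> complex ^ 'n" where
  "toeplitz \<gamma> \<psi> = pr_plus (\<lambda>z. \<gamma> z *v \<psi> z)"

definition loop_inv :: "(complex \<Rightarrow> complex ^ 'n ^ 'n) \<Rightarrow> complex \<Rightarrow> complex ^ 'n ^ 'n" where
  "loop_inv \<gamma> z = matrix_inv (\<gamma> z)"

definition P_op ::
    "(complex \<Rightarrow> complex ^ 'n ^ 'n) \<Rightarrow> (complex \<Rightarrow> complex ^ 'n) \<Rightarrow> complex \<Rightarrow> complex ^ 'n" where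
  "P_op \<gamma> = toeplitz \<gamma> \<circ> toeplitz (loop_inv \<gamma>)"

text \<open>
  The vector-valued contour integral is taken componentwise. At \<open>\<zeta> = z\<close> the integrand has a
  removable singularity; its value there is irrelevant for the integral.
\<close>

definition P_tilde ::
    "(complex \<Rightarrow> complex ^ 'n ^ 'n) \<Rightarrow> (complex \<Rightarrow> complex ^ 'n) \<Rightarrow> complex \<Rightarrow> complex ^ 'n" where
  "P_tilde \<gamma> \<psi> = pr_plus (\<lambda>z. \<psi> z + (1 / (2 * complex_of_real pi * \<i>)) *s
     (\<chi> i. contour_integral (circlepath 0 1)
             (\<lambda>\<zeta>. ((\<gamma> z ** loop_inv \<gamma> \<zeta> - mat 1) *v \<psi> \<zeta>) $ i / (\<zeta> - z))))"

definition extends_analytically :: "(complex \<Rightarrow> complex ^ 'n ^ 'n) \<Rightarrow> bool" where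
  "extends_analytically \<gamma> \<longleftrightarrow>
     (\<exists>U \<Gamma>. open U \<and> sphere 0 1 \<subseteq> U \<and>
        (\<forall>i j. (\<lambda>z. \<Gamma> z $ i $ j) holomorphic_on U) \<and> (\<forall>z\<in>sphere 0 1. \<Gamma> z = \<gamma> z))"

text \<open>
  Equality of operators from \<^const>\<open>H_plus\<close> to itself. Membership of the values in
  \<^const>\<open>H_plus\<close> also rules out an accidental coincidence of default values of \<^const>\<open>pr_plus\<close>.
\<close>

definition operator_eq_H_plus ::
    "((complex \<Rightarrow> complex ^ 'n) \<Rightarrow> complex \<Rightarrow> complex ^ 'n) \<Rightarrow>
     ((complex \<Rightarrow> complex ^ 'n) \<Rightarrow> complex \<Rightarrow> complex ^ 'n) \<Rightarrow> bool" where
  "operator_eq_H_plus A B \<longleftrightarrow>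
     (\<forall>\<psi>\<in>H_plus. A \<psi> \<in> H_plus \<and> B \<psi> \<in> H_plus \<and> (AE z in circle_measure. A \<psi> z = B \<psi> z))"

end

theory Submission imports Defs
begin

text \<open>
  For a matrix loop \<open>A\<close> and a vector function \<open>u\<close> put
  \<open>[C, A] u (z) = 1/(2 pi i) \<ointegral> (A(\<zeta>) - A(z)) u(\<zeta>) / (\<zeta> - z) d\<zeta>\<close>,
  the commutator of the Cauchy integral with multiplication by \<open>A\<close>. Formally the principal value
  of the Cauchy integral is half the difference of the projections to nonnegative and to negative
  Fourier modes, so that for \<open>u\<close> in $H_+$ and analytic \<open>A\<close>
  \[ \mathrm{pr}_+(A u) = A u + [C, A] u . \]
  This formula is the heart of the proof (\<open>toeplitz_eq\<close>). For \<open>A = \<gamma>\<inverse>\<close> and \<open>u = \<psi>\<close>, the identity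
  \<open>\<gamma>(z) \<gamma>\<inverse>(z) = I\<close> shows that the function which is projected in \<open>P_tilde\<close> equals
  \<open>\<gamma> (\<gamma>\<inverse> \<psi> + [C, \<gamma>\<inverse>] \<psi>)\<close> at every point of the circle (\<open>P_tilde_integrand\<close>). By the formula
  it is \<open>\<gamma> T(\<gamma>\<inverse>) \<psi>\<close> almost everywhere, and its projection is \<open>T(\<gamma>) T(\<gamma>\<inverse>) \<psi>\<close>.

  To prove the formula it suffices, entry by entry, to treat a scalar symbol \<open>a\<close> and a scalar Hardy
  function \<open>u\<close>, and to show that \<open>a u + [C, a] u\<close> has no negative Fourier modes while \<open>[C, a] u\<close> is
  orthogonal to the Hardy functions. Cauchy's formula on an annulus splits \<open>a\<close> on the circle as
  \<open>g + cnj c\<close> with \<open>g\<close> and \<open>c\<close> holomorphic on a disc of radius greater than 1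
  (\<open>circle_symbol_splitting\<close>). Everything then rests on one fact: multiplying a Hardy function by a
  function holomorphic on such a disc creates no negative modes
  (\<open>integral_holomorphic_mult_hardy\<close>).

  \<^item> The difference quotient of \<open>g\<close> is holomorphic in \<open>\<zeta>\<close>, so \<open>[C, g] u = 0\<close>.
  \<^item> The kernel of \<open>[C, cnj c]\<close> is the conjugate of a holomorphic one in both variables, and
    Fubini's theorem moves the pairing with a Hardy function inside, where it vanishes.
  \<^item> That \<open>cnj c u + [C, cnj c] u\<close> has no mode \<open>-n\<close> follows by induction on \<open>n\<close>, writing
    \<open>c(z) = c(0) + z d(z)\<close> and passing from \<open>c\<close> to \<open>d\<close>.
\<close>

text \<open>
  The dollar sign also denotes coefficients of power series, which makes matrix entries ambiguous;
  here it is reserved for vector components.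
\<close>
no_notation fps_nth (infixl "$" 75)

section \<open>Normalised arc length and contour integrals\<close>

interpretation circle: prob_space circle_measure
  by (rule prob_space_circle_measure)

interpretation torus: pair_sigma_finite circle_measure circle_measure
  by (intro pair_sigma_finite.intro circle.sigma_finite_measure_axioms)

lemma sets_circle_measure [measurable_cong]:
  "sets circle_measure = sets (restrict_space borel (sphere 0 1))"
  by (simp add: circle_measure_def)

lemma continuous_on_imp_measurable_circle:
  "continuous_on (sphere 0 1) f \<Longrightarrow> f \<in> borel_measurable circle_measure"
  by (simp add: borel_measurable_continuous_on_restrict cong: measurable_cong_sets
        measurable_cong_sets[OF sets_circle_measure refl])

lemma continuous_bounded_circle:
  fixes f :: "complex \<Rightarrow> complex"
  assumes "continuous_on (sphere 0 1) f"
  obtains C where "\<And>z. z \<in> sphere 0 1 \<Longrightarrow> norm (f z) \<le> C"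
proof -
  have "compact (f ` sphere 0 1)"
    by (intro compact_continuous_image assms) auto
  then obtain C where "\<forall>z\<in>sphere 0 1. norm (f z) \<le> C"
    by (auto dest!: compact_imp_bounded simp: bounded_iff)
  then show thesis by (intro that[of C]) blast
qed

lemma continuous_on_holomorphic_circle:
  assumes "h holomorphic_on ball 0 R" "R > 1"
  shows "continuous_on (sphere 0 1) h"
  by (rule continuous_on_subset[OF holomorphic_on_imp_continuous_on[OF assms(1)]])
     (use assms in auto)

lemma measurable_holomorphic_circle:
  assumes "h holomorphic_on ball 0 R" "R > 1"
  shows "h \<in> borel_measurable circle_measure"
  by (intro continuous_on_imp_measurable_circle continuous_on_holomorphic_circle[OF assms])

lemma measurable_cis_circle: "cis \<in> lborel \<rightarrow>\<^sub>M restrict_space borel (sphere 0 1)"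
  by (rule measurable_restrict_space2)
     (auto intro!: borel_measurable_continuous_onI continuous_intros)

lemma uniform_measure_circle_density:
  "uniform_measure lborel {0..2 * pi} =
     density lborel (\<lambda>t. ennreal (indicator {0..2 * pi} t / (2 * pi)))"
  unfolding uniform_measure_def
  by (intro density_cong AE_I2)
     (auto simp: divide_ennreal[symmetric] split: split_indicator)

lemma
  fixes f :: "complex \<Rightarrow> 'b::euclidean_space"
  assumes f: "integrable circle_measure f"
  shows circle_integrable_cis:
      "integrable lborel (\<lambda>t. (indicator {0..2 * pi} t / (2 * pi)) *\<^sub>R f (cis t))"
    and circle_integral_cis: "(LINT z|circle_measure. f z) =
      (LINT t|lborel. (indicator {0..2 * pi} t / (2 * pi)) *\<^sub>R f (cis t))"
proof -
  have cis: "cis \<in> uniform_measure lborel {0..2 * pi} \<rightarrow>\<^sub>M restrict_space borel (sphere 0 1)"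
    using measurable_cis_circle by (simp cong: measurable_cong_sets)
  have fm: "f \<in> borel_measurable (restrict_space borel (sphere 0 1))"
    using borel_measurable_integrable[OF f]
    by (simp add: measurable_cong_sets[OF sets_circle_measure refl])
  have fc: "(\<lambda>t. f (cis t)) \<in> borel_measurable lborel"
    by (rule measurable_compose[OF measurable_cis_circle fm])
  have "integrable (uniform_measure lborel {0..2 * pi}) (\<lambda>t. f (cis t))"
    using f unfolding circle_measure_def by (rule integrable_distr[OF cis])
  then show "integrable lborel (\<lambda>t. (indicator {0..2 * pi} t / (2 * pi)) *\<^sub>R f (cis t))"
    unfolding uniform_measure_circle_density
    by (subst (asm) integrable_density) (use fc in auto)
  have "(LINT z|circle_measure. f z) = (LINT t|uniform_measure lborel {0..2 * pi}. f (cis t))"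
    unfolding circle_measure_def by (rule integral_distr[OF cis fm])
  also have "\<dots> = (LINT t|lborel. (indicator {0..2 * pi} t / (2 * pi)) *\<^sub>R f (cis t))"
    unfolding uniform_measure_circle_density
    by (rule integral_density) (use fc in auto)
  finally show "(LINT z|circle_measure. f z) =
      (LINT t|lborel. (indicator {0..2 * pi} t / (2 * pi)) *\<^sub>R f (cis t))" .
qed

text \<open>
  On the unit circle \<open>d\<zeta> = 2 pi i \<zeta> d\<mu>\<close> for normalised arc length \<open>\<mu>\<close>. Only integrability is asked
  of the integrand, because it will be a bounded kernel times an $L^2$ function.
\<close>
lemma has_contour_integral_circle:
  assumes "integrable circle_measure (\<lambda>z. z * f z)"
  shows "(f has_contour_integral 2 * complex_of_real pi * \<i> * (LINT z|circle_measure. z * f z))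
           (circlepath 0 1)"
proof -
  let ?F = "\<lambda>t. (indicator {0..2 * pi} t / (2 * pi)) *\<^sub>R (cis t * f (cis t))"
  have "(?F has_integral (LINT z|circle_measure. z * f z)) UNIV"
    using has_integral_integral_lborel[OF circle_integrable_cis[OF assms]]
    by (simp add: circle_integral_cis[OF assms])
  then have "((\<lambda>t. (2 * complex_of_real pi * \<i>) * ?F t) has_integral
       2 * complex_of_real pi * \<i> * (LINT z|circle_measure. z * f z)) UNIV"
    by (rule has_integral_mult_right)
  then have "((\<lambda>t. if t \<in> {0..2 * pi} then f (cis t) * \<i> * cis t else 0) has_integral
       2 * complex_of_real pi * \<i> * (LINT z|circle_measure. z * f z)) UNIV"
    by (rule has_integral_eq_rhs[OF has_integral_eq, rotated])
       (auto simp: indicator_def scaleR_conv_of_real field_simps)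
  then show ?thesis
    unfolding circlepath_def
    by (subst has_contour_integral_part_circlepath_iff)
       (simp_all only: has_integral_restrict_UNIV pi_gt_zero mult_pos_pos zero_less_numeral
          add_0 of_real_1 mult_1_left mult_1_right)
qed

lemma AE_circle_neq: "AE z in circle_measure. z \<noteq> w"
proof -
  \<comment> \<open>A nonempty fibre of \<open>cis\<close> is a coset of the multiples of \<open>2 pi\<close>.\<close>
  have "countable (cis -` {w})"
  proof (cases "\<exists>s. w = cis s")
    case True
    then obtain s where "w = cis s" by blast
    have "t \<in> range (\<lambda>n::int. s + 2 * pi * n)" if "cis t = w" for t
      using that \<open>w = cis s\<close> sin_cos_eq_iff[of t s] by (auto simp: complex_eq_iff image_iff)
    then have "cis -` {w} \<subseteq> range (\<lambda>n::int. s + 2 * pi * n)"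
      by auto
    then show ?thesis by (rule countable_subset) auto
  next
    case False
    then have "cis -` {w} = {}" by auto
    then show ?thesis by simp
  qed
  then have "AE t in lborel. t \<notin> cis -` {w}"
    by (intro AE_not_in countable_imp_null_set_lborel)
  then have *: "AE t in uniform_measure lborel {0..2 * pi}. cis t \<noteq> w"
    unfolding uniform_measure_circle_density by (subst AE_density) auto
  have cis: "cis \<in> uniform_measure lborel {0..2 * pi} \<rightarrow>\<^sub>M restrict_space borel (sphere 0 1)"
    using measurable_cis_circle by (simp cong: measurable_cong_sets)
  show ?thesis
    unfolding circle_measure_def
    by (subst AE_distr_iff[OF cis])
       (use * in \<open>auto simp: sets_restrict_space space_restrict_space intro!: image_eqI[where x="-{w}"]\<close>)
qed

section \<open>Square-integrable and Hardy functions\<close>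

definition square_integrable :: "(complex \<Rightarrow> complex) \<Rightarrow> bool" where
  "square_integrable u \<longleftrightarrow> u \<in> borel_measurable circle_measure \<and>
     integrable circle_measure (\<lambda>z. (norm (u z))\<^sup>2)"

text \<open>
  The scalar Hardy space: the integral against \<open>z ^ Suc n\<close> is the Fourier coefficient of index
  \<open>-(n + 1)\<close>.
\<close>
definition hardy :: "(complex \<Rightarrow> complex) \<Rightarrow> bool" where
  "hardy u \<longleftrightarrow> square_integrable u \<and> (\<forall>n. (LINT z|circle_measure. z ^ Suc n * u z) = 0)"

lemma square_integrableD:
  assumes "square_integrable u"
  shows "u \<in> borel_measurable circle_measure" "integrable circle_measure (\<lambda>z. (norm (u z))\<^sup>2)"
  using assms by (auto simp: square_integrable_def)

lemma AE_circle_norm: "AE z in circle_measure. norm z = 1"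
  by (rule AE_I2) simp

lemma square_integrable_bounded:
  assumes "u \<in> borel_measurable circle_measure" "\<And>z. z \<in> sphere 0 1 \<Longrightarrow> norm (u z) \<le> B"
  shows "square_integrable u"
  unfolding square_integrable_def
proof (intro conjI assms circle.integrable_const_bound[where B="B\<^sup>2"])
  show "AE z in circle_measure. norm ((norm (u z))\<^sup>2) \<le> B\<^sup>2"
    by (rule AE_I2) (simp add: assms power_mono)
qed (use assms in auto)

lemma square_integrable_add:
  assumes "square_integrable u" "square_integrable v"
  shows "square_integrable (\<lambda>z. u z + v z)"
proof -
  note [measurable] = square_integrableD(1)[OF assms(1)] square_integrableD(1)[OF assms(2)]
  have "integrable circle_measure (\<lambda>z. 2 * (norm (u z))\<^sup>2 + 2 * (norm (v z))\<^sup>2)"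
    using assms by (auto simp: square_integrable_def)
  moreover have le: "(norm (u z + v z))\<^sup>2 \<le> 2 * (norm (u z))\<^sup>2 + 2 * (norm (v z))\<^sup>2" for z
  proof -
    have "(norm (u z + v z))\<^sup>2 \<le> (norm (u z) + norm (v z))\<^sup>2"
      by (intro power_mono norm_triangle_ineq) simp
    also have "\<dots> \<le> 2 * (norm (u z))\<^sup>2 + 2 * (norm (v z))\<^sup>2"
      using sum_squares_bound[of "norm (u z)" "norm (v z)"] by (simp add: power2_sum)
    finally show ?thesis .
  qed
  ultimately have "integrable circle_measure (\<lambda>z. (norm (u z + v z))\<^sup>2)"
    by (elim Bochner_Integration.integrable_bound) (use le in auto)
  then show ?thesis by (simp add: square_integrable_def)
qed

lemma square_integrable_bounded_mult:
  assumes "a \<in> borel_measurable circle_measure" "\<And>z. z \<in> sphere 0 1 \<Longrightarrow> norm (a z) \<le> B"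
    and u: "square_integrable u"
  shows "square_integrable (\<lambda>z. a z * u z)"
proof -
  note [measurable] = square_integrableD(1)[OF u] assms(1)
  have "integrable circle_measure (\<lambda>z. B\<^sup>2 * (norm (u z))\<^sup>2)"
    using u by (auto simp: square_integrable_def)
  then have "integrable circle_measure (\<lambda>z. (norm (a z * u z))\<^sup>2)"
    by (rule Bochner_Integration.integrable_bound)
       (auto simp: norm_mult power_mult_distrib assms(2) intro!: mult_right_mono power_mono)
  then show ?thesis by (simp add: square_integrable_def)
qed

lemma integrable_mult_square_integrable:
  assumes "square_integrable u" "square_integrable v"
  shows "integrable circle_measure (\<lambda>z. u z * v z)"
proof -
  note [measurable] = square_integrableD(1)[OF assms(1)] square_integrableD(1)[OF assms(2)]
  have "integrable circle_measure (\<lambda>z. (norm (u z))\<^sup>2 + (norm (v z))\<^sup>2)"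
    using assms by (auto simp: square_integrable_def)
  moreover have le: "norm (u z * v z) \<le> norm ((norm (u z))\<^sup>2 + (norm (v z))\<^sup>2)" for z
  proof -
    have "2 * (norm (u z) * norm (v z)) \<le> (norm (u z))\<^sup>2 + (norm (v z))\<^sup>2"
      using sum_squares_bound[of "norm (u z)" "norm (v z)"] by (simp add: mult.assoc)
    moreover have "0 \<le> norm (u z) * norm (v z)" by simp
    ultimately show ?thesis unfolding norm_mult real_norm_def by linarith
  qed
  ultimately show ?thesis
    by (elim Bochner_Integration.integrable_bound) (use le in auto)
qed

lemma square_integrable_cnj:
  "square_integrable u \<Longrightarrow> square_integrable (\<lambda>z. cnj (u z))"
  unfolding square_integrable_def
  by (auto intro: measurable_compose[OF _ borel_measurable_continuous_onI]
      intro!: continuous_intros)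

lemma square_integrable_const: "square_integrable (\<lambda>z. c)"
  by (rule square_integrable_bounded[where B="norm c"]) auto

lemma square_integrable_imp_integrable:
  assumes "square_integrable u" shows "integrable circle_measure u"
  using integrable_mult_square_integrable[OF assms square_integrable_const[of 1]] by simp

lemma integrable_bounded_mult:
  assumes "a \<in> borel_measurable circle_measure" "\<And>z. z \<in> sphere 0 1 \<Longrightarrow> norm (a z) \<le> B"
    and "square_integrable u"
  shows "integrable circle_measure (\<lambda>z. a z * u z)"
  by (rule square_integrable_imp_integrable[OF square_integrable_bounded_mult[OF assms]])

lemma measurable_power_circle [measurable]: "(\<lambda>z. z ^ n) \<in> borel_measurable circle_measure"
  by (intro continuous_on_imp_measurable_circle continuous_intros)

lemma measurable_ident_circle [measurable]: "(\<lambda>z. z) \<in> borel_measurable circle_measure"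
  by (intro continuous_on_imp_measurable_circle continuous_intros)

lemma integrable_power_mult:
  assumes "square_integrable u" shows "integrable circle_measure (\<lambda>z. z ^ n * u z)"
  by (rule integrable_bounded_mult[where B=1]) (auto simp: assms norm_power)

lemma hardyD:
  assumes "hardy u"
  shows "square_integrable u" "u \<in> borel_measurable circle_measure"
    "n > 0 \<Longrightarrow> (LINT z|circle_measure. z ^ n * u z) = 0"
  using assms by (cases n; auto simp: hardy_def square_integrable_def)+

lemma hardyI:
  assumes "square_integrable u" "\<And>n. n > 0 \<Longrightarrow> (LINT z|circle_measure. z ^ n * u z) = 0"
  shows "hardy u"
  unfolding hardy_def using assms(1) assms(2)[OF zero_less_Suc] by blast

text \<open>As a contour integral this is the integral of a polynomial around a closed curve.\<close>
lemma integral_power_circle: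
  assumes "n > 0" shows "(LINT z|circle_measure. z ^ n) = 0"
proof -
  have eq: "z * z ^ (n - 1) = z ^ n" for z :: complex
    using assms by (cases n) auto
  have "((\<lambda>z. z ^ (n - 1)) has_contour_integral
      2 * complex_of_real pi * \<i> * (LINT z|circle_measure. z ^ n)) (circlepath 0 1)"
    using has_contour_integral_circle[of "\<lambda>z. z ^ (n - 1)"]
      integrable_power_mult[OF square_integrable_const[of 1], of n]
    unfolding eq by simp
  moreover have "((\<lambda>z. z ^ (n - 1)) has_contour_integral 0) (circlepath 0 1)"
    by (rule Cauchy_theorem_disc_simple[of _ 0 2]) (auto intro!: holomorphic_intros)
  ultimately show ?thesis
    by (auto dest: has_contour_integral_unique)
qed

lemma hardy_const: "hardy (\<lambda>z. c)"
  by (rule hardyI) (auto simp: square_integrable_const integral_power_circle)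

text \<open>
  The power series of \<open>h\<close> converges absolutely and uniformly on the circle because its radius
  exceeds 1, so it may be integrated term by term; each term only shifts the modes of \<open>u\<close> upwards.
\<close>
lemma integral_holomorphic_mult_hardy:
  assumes h: "h holomorphic_on ball 0 R" and R: "R > 1" and u: "hardy u" and n: "n > 0"
  shows "(LINT z|circle_measure. z ^ n * (h z * u z)) = 0"
proof -
  define c where "c = (\<lambda>k. (deriv ^^ k) h 0 / fact k)"
  have sums: "(\<lambda>k. c k * z ^ k) sums h z" if "norm z < R" for z
    using holomorphic_power_series[OF h, of z] that by (simp add: c_def)
  obtain r where r: "1 < r" "r < R" using R dense by blast
  have "summable (\<lambda>k. c k * of_real r ^ k)"
    using sums[of "of_real r"] r by (auto intro: sums_summable)
  then have "summable (\<lambda>k. norm (c k * 1 ^ k))"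
    by (rule powser_insidea) (use r in auto)
  then have sc: "summable (\<lambda>k. norm (c k))" by simp
  have int: "integrable circle_measure (\<lambda>z. z ^ (n + k) * u z)" for k
    by (rule integrable_power_mult[OF hardyD(1)[OF u]])
  have zero: "(LINT z|circle_measure. c k * (z ^ (n + k) * u z)) = 0" for k
    using hardyD(3)[OF u, of "n + k"] n by simp
  have normeq: "norm (c k * (z ^ (n + k) * u z)) = norm (c k) * norm (u z)"
    if "norm z = 1" for z k using that by (simp add: norm_mult norm_power)
  have "(LINT z|circle_measure. z ^ n * (h z * u z)) =
      (LINT z|circle_measure. (\<Sum>k. c k * (z ^ (n + k) * u z)))"
  proof (rule Bochner_Integration.integral_cong[OF refl])
    fix z assume "z \<in> space circle_measure"
    then have "(\<lambda>k. (c k * z ^ k) * (z ^ n * u z)) sums (h z * (z ^ n * u z))"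
      using R by (intro sums_mult2 sums) auto
    then show "z ^ n * (h z * u z) = (\<Sum>k. c k * (z ^ (n + k) * u z))"
      by (simp add: sums_iff power_add mult_ac)
  qed
  also have "\<dots> = (\<Sum>k. LINT z|circle_measure. c k * (z ^ (n + k) * u z))"
  proof (rule integral_suminf)
    show "integrable circle_measure (\<lambda>z. c k * (z ^ (n + k) * u z))" for k
      using int by simp
    show "AE z in circle_measure. summable (\<lambda>k. norm (c k * (z ^ (n + k) * u z)))"
      using AE_circle_norm
      by eventually_elim (simp add: normeq summable_mult2[OF sc])
    have "(LINT z|circle_measure. norm (c k * (z ^ (n + k) * u z))) =
        (LINT z|circle_measure. norm (c k) * norm (u z))" for k
      by (rule Bochner_Integration.integral_cong[OF refl]) (simp add: normeq)
    then show "summable (\<lambda>k. LINT z|circle_measure. norm (c k * (z ^ (n + k) * u z)))"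
      by (simp add: summable_mult2[OF sc])
  qed
  also have "\<dots> = 0" by (simp only: zero suminf_zero)
  finally show ?thesis .
qed

section \<open>The commutator with the Cauchy integral\<close>

text \<open>
  The value on the diagonal is 0, by the convention for division by zero. The
  quotient is then jointly measurable as a quotient of measurable functions and keeps every
  Lipschitz bound of \<open>f\<close>. Points are null sets of the circle, so integrals over one variable do
  not see the difference from the holomorphic extension.
\<close>
definition diff_quotient :: "(complex \<Rightarrow> complex) \<Rightarrow> complex \<Rightarrow> complex \<Rightarrow> complex" where
  "diff_quotient f z \<zeta> = (f \<zeta> - f z) / (\<zeta> - z)"

lemma diff_quotient_commute: "diff_quotient f z \<zeta> = diff_quotient f \<zeta> z"
proof -
  have "(f z - f \<zeta>) / (z - \<zeta>) = (- (f \<zeta> - f z)) / (- (\<zeta> - z))"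
    by (simp only: minus_diff_eq)
  then show ?thesis unfolding diff_quotient_def by (simp only: minus_divide_divide)
qed

text \<open>
  The factor \<open>\<zeta>\<close> turns normalised arc length into \<open>d\<zeta>/(2 pi i)\<close>: this is the commutator of the
  Cauchy integral with multiplication by \<open>a\<close>, applied to \<open>u\<close>.
\<close>
definition cauchy_commutator ::
    "(complex \<Rightarrow> complex) \<Rightarrow> (complex \<Rightarrow> complex) \<Rightarrow> complex \<Rightarrow> complex" where
  "cauchy_commutator a u z = (LINT \<zeta>|circle_measure. \<zeta> * (diff_quotient a z \<zeta> * u \<zeta>))"

lemma diff_quotient_bounded:
  assumes h: "h holomorphic_on ball 0 R" and R: "R > 1"
  obtains B where "\<And>z \<zeta>. z \<in> sphere 0 1 \<Longrightarrow> \<zeta> \<in> sphere 0 1 \<Longrightarrow> norm (diff_quotient h z \<zeta>) \<le> B"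
proof -
  have sub: "cball 0 1 \<subseteq> ball (0::complex) R" using R by auto
  have "continuous_on (cball 0 1) (deriv h)"
    by (intro holomorphic_on_imp_continuous_on holomorphic_on_subset[OF holomorphic_deriv[OF h] sub])
       auto
  then have "bounded (deriv h ` cball 0 1)"
    by (intro compact_imp_bounded compact_continuous_image) auto
  then obtain B where B: "B > 0" "\<And>z. z \<in> cball 0 1 \<Longrightarrow> norm (deriv h z) \<le> B"
    by (auto simp: bounded_pos)
  have "norm (diff_quotient h z \<zeta>) \<le> B" if "z \<in> sphere 0 1" "\<zeta> \<in> sphere 0 1" for z \<zeta>
  proof -
    have "norm (h \<zeta> - h z) \<le> B * norm (\<zeta> - z)"
    proof (rule field_differentiable_bound[OF convex_cball[of 0 1]])
      fix w :: complex assume w: "w \<in> cball 0 1"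
      show "(h has_field_derivative deriv h w) (at w within cball 0 1)"
        by (rule has_field_derivative_at_within, rule holomorphic_derivI[OF h open_ball])
           (use w sub in blast)
      show "norm (deriv h w) \<le> B" by (rule B(2)[OF w])
    qed (use that in \<open>simp_all add: dist_norm\<close>)
    then show ?thesis
      using B(1) by (cases "\<zeta> = z") (simp_all add: diff_quotient_def norm_divide pos_divide_le_eq)
  qed
  then show thesis by (intro that)
qed

lemma measurable_diff_quotient [measurable]:
  assumes [measurable]: "f \<in> borel_measurable circle_measure"
  shows "(\<lambda>(z, \<zeta>). diff_quotient f z \<zeta>) \<in> borel_measurable (circle_measure \<Otimes>\<^sub>M circle_measure)"
  unfolding diff_quotient_def by measurable

lemma measurable_diff_quotient1 [measurable]:
  assumes [measurable]: "f \<in> borel_measurable circle_measure"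
  shows "(\<lambda>\<zeta>. diff_quotient f z \<zeta>) \<in> borel_measurable circle_measure"
  unfolding diff_quotient_def by measurable

text \<open>
  The singularity of the quotient at \<open>z\<close> is removable, so away from one point of the circle it
  agrees with a function holomorphic on the disc. With exponent 1 this says that holomorphic
  symbols have vanishing commutator on Hardy functions.
\<close>
lemma diff_quotient_holomorphic_mult_hardy:
  assumes h: "h holomorphic_on ball 0 R" and R: "R > 1" and u: "hardy u" and n: "n > 0"
  shows "(LINT \<zeta>|circle_measure. \<zeta> ^ n * (diff_quotient h z \<zeta> * u \<zeta>)) = 0"
proof -
  define q where "q = (\<lambda>\<zeta>. if \<zeta> = z then deriv h z else (h \<zeta> - h z) / (\<zeta> - z))"
  have q: "q holomorphic_on ball 0 R"
    unfolding q_def by (rule pole_lemma_open[OF h open_ball])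
  note [measurable] = measurable_holomorphic_circle[OF q R] measurable_holomorphic_circle[OF h R]
    hardyD(2)[OF u]
  have "(LINT \<zeta>|circle_measure. \<zeta> ^ n * (diff_quotient h z \<zeta> * u \<zeta>)) =
        (LINT \<zeta>|circle_measure. \<zeta> ^ n * (q \<zeta> * u \<zeta>))"
  proof (rule integral_cong_AE)
    show "AE \<zeta> in circle_measure. \<zeta> ^ n * (diff_quotient h z \<zeta> * u \<zeta>) = \<zeta> ^ n * (q \<zeta> * u \<zeta>)"
      using AE_circle_neq[of z] by eventually_elim (simp add: q_def diff_quotient_def)
  qed measurable
  also have "\<dots> = 0" by (rule integral_holomorphic_mult_hardy[OF q R u n])
  finally show ?thesis .
qed

lemma circle_cnj_eq: "z \<in> sphere 0 1 \<Longrightarrow> cnj z = 1 / z"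
  using divide_conv_cnj[of z 1] by (simp only: mem_sphere_0 mult_1_left)

text \<open>
  On the circle conjugation is inversion, which turns the denominator \<open>\<zeta> - z\<close> into its conjugate
  up to the factor \<open>- z \<zeta>\<close>. Hence the kernel for a conjugated symbol is again the conjugate of a
  holomorphic kernel, now with an additional factor that makes all its modes in \<open>z\<close> negative.
\<close>
lemma diff_quotient_cnj:
  assumes "z \<in> sphere 0 1" "\<zeta> \<in> sphere 0 1"
  shows "\<zeta> * diff_quotient (\<lambda>z. cnj (c z)) z \<zeta> = - (cnj z * cnj (diff_quotient c z \<zeta>))"
proof (cases "\<zeta> = z")
  case False
  have nz: "z \<noteq> 0" "\<zeta> \<noteq> 0" using assms by auto
  have cnj: "cnj z = 1 / z" "cnj \<zeta> = 1 / \<zeta>" using assms circle_cnj_eq by blast+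
  define d where "d = \<zeta> - z"
  have d: "d \<noteq> 0" using False by (simp add: d_def)
  have diff: "cnj \<zeta> - cnj z = - (\<zeta> - z) / (z * \<zeta>)"
    unfolding cnj using nz by (simp add: field_simps)
  have "\<zeta> * (p / d) = - (1 / z * (p / (- d / (z * \<zeta>))))" for p
    using nz d by simp
  from this[of "cnj (c \<zeta>) - cnj (c z)"] show ?thesis
    unfolding diff_quotient_def complex_cnj_divide complex_cnj_diff unfolding diff unfolding cnj(1) d_def .
qed (simp add: diff_quotient_def)

lemma cauchy_commutator_cnj:
  assumes "z \<in> sphere 0 1"
  shows "cauchy_commutator (\<lambda>z. cnj (c z)) u z =
    - (cnj z * (LINT \<zeta>|circle_measure. cnj (diff_quotient c z \<zeta>) * u \<zeta>))"
proof -
  have "cauchy_commutator (\<lambda>z. cnj (c z)) u z =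
      (LINT \<zeta>|circle_measure. - cnj z * (cnj (diff_quotient c z \<zeta>) * u \<zeta>))"
    unfolding cauchy_commutator_def
    by (rule Bochner_Integration.integral_cong[OF refl])
       (use diff_quotient_cnj[OF assms] in \<open>simp add: mult.assoc[symmetric]\<close>)
  then show ?thesis by (simp del: mult_minus_left)
qed

text \<open>
  Everything about the commutator as an integral operator follows from its kernel being bounded and
  jointly measurable on the torus, so these facts are proved for an arbitrary such kernel.
\<close>
context
  fixes K :: "complex \<Rightarrow> complex \<Rightarrow> complex" and B :: real
  assumes K_measurable [measurable]:
      "(\<lambda>(z, \<zeta>). K z \<zeta>) \<in> borel_measurable (circle_measure \<Otimes>\<^sub>M circle_measure)"
    and K_bounded: "\<And>z \<zeta>. z \<in> sphere 0 1 \<Longrightarrow> \<zeta> \<in> sphere 0 1 \<Longrightarrow> norm (K z \<zeta>) \<le> B"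
begin

lemma bounded_kernel_integrable:
  assumes "z \<in> sphere 0 1" "square_integrable u"
  shows "integrable circle_measure (\<lambda>\<zeta>. K z \<zeta> * u \<zeta>)"
proof (rule integrable_bounded_mult[where B=B])
  show "K z \<in> borel_measurable circle_measure"
    using measurable_compose_Pair1[of z circle_measure, OF _ K_measurable] assms by simp
qed (use assms K_bounded in auto)

lemma bounded_kernel_square_integrable:
  assumes u: "square_integrable u"
  shows "square_integrable (\<lambda>z. LINT \<zeta>|circle_measure. K z \<zeta> * u \<zeta>)"
proof (rule square_integrable_bounded)
  note [measurable] = square_integrableD(1)[OF u]
  show "(\<lambda>z. LINT \<zeta>|circle_measure. K z \<zeta> * u \<zeta>) \<in> borel_measurable circle_measure"
    by measurable
  fix z :: complex assume z: "z \<in> sphere 0 1"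
  have "norm (LINT \<zeta>|circle_measure. K z \<zeta> * u \<zeta>) \<le> (LINT \<zeta>|circle_measure. norm (K z \<zeta> * u \<zeta>))"
    by (rule integral_norm_bound)
  also have "\<dots> \<le> (LINT \<zeta>|circle_measure. B * norm (u \<zeta>))"
    using integrable_norm[OF bounded_kernel_integrable[OF z u]]
      square_integrable_imp_integrable[OF u] K_bounded[OF z]
    by (intro integral_mono) (auto simp: norm_mult intro!: mult_right_mono)
  finally show "norm (LINT \<zeta>|circle_measure. K z \<zeta> * u \<zeta>) \<le>
      (LINT \<zeta>|circle_measure. B * norm (u \<zeta>))" .
qed

lemma bounded_kernel_Fubini:
  assumes u: "square_integrable u" and v: "square_integrable v"
  shows "(LINT z|circle_measure. v z * (LINT \<zeta>|circle_measure. K z \<zeta> * u \<zeta>)) =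
         (LINT \<zeta>|circle_measure. u \<zeta> * (LINT z|circle_measure. K z \<zeta> * v z))"
proof -
  note [measurable] = square_integrableD(1)[OF u] square_integrableD(1)[OF v]
  have iu: "integrable circle_measure u" and iv: "integrable circle_measure v"
    using u v by (auto intro: square_integrable_imp_integrable)
  have "integrable (circle_measure \<Otimes>\<^sub>M circle_measure) (\<lambda>(z, \<zeta>). v z * u \<zeta>)"
    by (rule torus.Fubini_integrable) (use iu iv in \<open>auto simp: norm_mult\<close>)
  then have "integrable (circle_measure \<Otimes>\<^sub>M circle_measure) (\<lambda>p. B * (norm (v (fst p) * u (snd p))))"
    by (auto simp: case_prod_beta')
  then have int: "integrable (circle_measure \<Otimes>\<^sub>M circle_measure) (\<lambda>(z, \<zeta>). v z * (K z \<zeta> * u \<zeta>))"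
  proof (rule Bochner_Integration.integrable_bound)
    show "AE p in circle_measure \<Otimes>\<^sub>M circle_measure.
        norm (case p of (z, \<zeta>) \<Rightarrow> v z * (K z \<zeta> * u \<zeta>)) \<le> norm (B * norm (v (fst p) * u (snd p)))"
    proof (rule AE_I2)
      fix p assume "p \<in> space (circle_measure \<Otimes>\<^sub>M circle_measure)"
      then have "norm (K (fst p) (snd p)) \<le> \<bar>B\<bar>"
        using K_bounded[of "fst p" "snd p"] by (auto simp: space_pair_measure)
      then have "norm (K (fst p) (snd p)) * (norm (v (fst p)) * norm (u (snd p)))
          \<le> \<bar>B\<bar> * (norm (v (fst p)) * norm (u (snd p)))"
        by (rule mult_right_mono) simp
      then show "norm (case p of (z, \<zeta>) \<Rightarrow> v z * (K z \<zeta> * u \<zeta>)) \<le> norm (B * norm (v (fst p) * u (snd p)))"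
        by (simp add: case_prod_beta norm_mult abs_mult mult_ac)
    qed
  qed measurable
  have "(LINT z|circle_measure. v z * (LINT \<zeta>|circle_measure. K z \<zeta> * u \<zeta>)) =
      (LINT z|circle_measure. LINT \<zeta>|circle_measure. v z * (K z \<zeta> * u \<zeta>))"
    by simp
  also have "\<dots> = (LINT \<zeta>|circle_measure. LINT z|circle_measure. v z * (K z \<zeta> * u \<zeta>))"
    by (rule torus.Fubini_integral[symmetric]) (use int in simp)
  also have "\<dots> = (LINT \<zeta>|circle_measure. LINT z|circle_measure. u \<zeta> * (K z \<zeta> * v z))"
    by (simp add: mult_ac)
  also have "\<dots> = (LINT \<zeta>|circle_measure. u \<zeta> * (LINT z|circle_measure. K z \<zeta> * v z))"
    by simp
  finally show ?thesis .
qed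

end

section \<open>Conjugates of holomorphic symbols\<close>

lemma measurable_cnj_circle:
  "f \<in> borel_measurable M \<Longrightarrow> (\<lambda>z. cnj (f z)) \<in> borel_measurable M"
  by (rule measurable_compose[OF _ borel_measurable_continuous_onI]) (auto intro!: continuous_intros)

lemma cnj_diff_quotient_kernel:
  assumes c: "c holomorphic_on ball 0 R" and R: "R > 1"
  obtains B where
    "(\<lambda>(z, \<zeta>). cnj (diff_quotient c z \<zeta>)) \<in> borel_measurable (circle_measure \<Otimes>\<^sub>M circle_measure)"
    "\<And>z \<zeta>. z \<in> sphere 0 1 \<Longrightarrow> \<zeta> \<in> sphere 0 1 \<Longrightarrow> norm (cnj (diff_quotient c z \<zeta>)) \<le> B"
proof -
  obtain B where B: "\<And>z \<zeta>. z \<in> sphere 0 1 \<Longrightarrow> \<zeta> \<in> sphere 0 1 \<Longrightarrow> norm (diff_quotient c z \<zeta>) \<le> B"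
    by (rule diff_quotient_bounded[OF c R]) blast
  have "(\<lambda>(z, \<zeta>). cnj (diff_quotient c z \<zeta>)) \<in> borel_measurable (circle_measure \<Otimes>\<^sub>M circle_measure)"
    using measurable_cnj_circle[OF measurable_diff_quotient[OF measurable_holomorphic_circle[OF c R]]]
    by (simp add: case_prod_beta')
  with B show thesis by (intro that[of B]) simp_all
qed

lemma square_integrable_cong:
  assumes "\<And>z. z \<in> sphere 0 1 \<Longrightarrow> u z = v z"
  shows "square_integrable u \<longleftrightarrow> square_integrable v"
  unfolding square_integrable_def
  by (intro arg_cong2[where f="(\<and>)"] measurable_cong Bochner_Integration.integrable_cong)
     (use assms in auto)

lemma square_integrable_circle_mult:
  assumes "square_integrable u"
  shows "square_integrable (\<lambda>z. cnj z * u z)"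
  by (rule square_integrable_bounded_mult[where B=1])
     (auto simp: assms intro!: measurable_cnj_circle)

lemma square_integrable_uminus: "square_integrable u \<Longrightarrow> square_integrable (\<lambda>z. - u z)"
  by (auto simp: square_integrable_def)

lemma square_integrable_cauchy_commutator_cnj:
  assumes c: "c holomorphic_on ball 0 R" and R: "R > 1" and u: "square_integrable u"
  shows "square_integrable (cauchy_commutator (\<lambda>z. cnj (c z)) u)"
proof -
  obtain B where
    "(\<lambda>(z, \<zeta>). cnj (diff_quotient c z \<zeta>)) \<in> borel_measurable (circle_measure \<Otimes>\<^sub>M circle_measure)"
    "\<And>z \<zeta>. z \<in> sphere 0 1 \<Longrightarrow> \<zeta> \<in> sphere 0 1 \<Longrightarrow> norm (cnj (diff_quotient c z \<zeta>)) \<le> B"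
    by (rule cnj_diff_quotient_kernel[OF c R]) blast
  from bounded_kernel_square_integrable[OF this u]
  show ?thesis
    by (subst square_integrable_cong[OF cauchy_commutator_cnj])
       (auto intro!: square_integrable_uminus square_integrable_circle_mult)
qed

text \<open>
  After exchanging the integrals, the inner one pairs the Hardy function \<open>h\<close> with \<open>z\<close> times a
  difference quotient that is holomorphic in \<open>z\<close>; such pairings vanish.
\<close>
lemma cauchy_commutator_cnj_orthogonal:
  assumes c: "c holomorphic_on ball 0 R" and R: "R > 1" and u: "square_integrable u" and h: "hardy h"
  shows "(LINT z|circle_measure. cauchy_commutator (\<lambda>z. cnj (c z)) u z * cnj (h z)) = 0"
proof -
  obtain B where B:
    "(\<lambda>(z, \<zeta>). cnj (diff_quotient c z \<zeta>)) \<in> borel_measurable (circle_measure \<Otimes>\<^sub>M circle_measure)"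
    "\<And>z \<zeta>. z \<in> sphere 0 1 \<Longrightarrow> \<zeta> \<in> sphere 0 1 \<Longrightarrow> norm (cnj (diff_quotient c z \<zeta>)) \<le> B"
    by (rule cnj_diff_quotient_kernel[OF c R]) blast
  have v: "square_integrable (\<lambda>z. cnj z * cnj (h z))"
    by (intro square_integrable_circle_mult square_integrable_cnj hardyD(1)[OF h])
  have "(LINT z|circle_measure. cauchy_commutator (\<lambda>z. cnj (c z)) u z * cnj (h z)) =
      (LINT z|circle_measure. - ((cnj z * cnj (h z)) * (LINT \<zeta>|circle_measure. cnj (diff_quotient c z \<zeta>) * u \<zeta>)))"
    by (rule Bochner_Integration.integral_cong[OF refl]) (simp add: cauchy_commutator_cnj)
  also have "\<dots> = - (LINT \<zeta>|circle_measure. u \<zeta> *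
      (LINT z|circle_measure. cnj (diff_quotient c z \<zeta>) * (cnj z * cnj (h z))))"
    using bounded_kernel_Fubini[OF B u v] by simp
  also have "(\<lambda>\<zeta>. LINT z|circle_measure. cnj (diff_quotient c z \<zeta>) * (cnj z * cnj (h z))) = (\<lambda>\<zeta>. 0)"
  proof
    fix \<zeta>
    have "(LINT z|circle_measure. cnj (diff_quotient c z \<zeta>) * (cnj z * cnj (h z))) =
        (LINT z|circle_measure. cnj (z ^ 1 * (diff_quotient c \<zeta> z * h z)))"
      by (simp add: diff_quotient_commute[of c \<zeta>] mult_ac)
    also have "\<dots> = cnj (LINT z|circle_measure. z ^ 1 * (diff_quotient c \<zeta> z * h z))"
      by (simp only: Bochner_Integration.integral_cnj)
    also have "\<dots> = 0"
      by (simp only: diff_quotient_holomorphic_mult_hardy[OF c R h zero_less_one] complex_cnj_zero)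
    finally show "(LINT z|circle_measure. cnj (diff_quotient c z \<zeta>) * (cnj z * cnj (h z))) = 0" .
  qed
  finally show ?thesis by simp
qed

lemma holomorphic_split_at_0:
  fixes c :: "complex \<Rightarrow> complex"
  assumes "c holomorphic_on ball 0 R"
  obtains d where "d holomorphic_on ball 0 R" "\<And>z. c z = c 0 + z * d z"
proof
  show "(\<lambda>z. if z = 0 then deriv c 0 else (c z - c 0) / (z - 0)) holomorphic_on ball 0 R"
    by (rule pole_lemma_open[OF assms open_ball])
  show "c z = c 0 + z * (if z = 0 then deriv c 0 else (c z - c 0) / (z - 0))" for z
    by simp
qed

lemma square_integrable_cnj_holomorphic_mult:
  assumes c: "c holomorphic_on ball 0 R" and R: "R > 1" and u: "square_integrable u"
  shows "square_integrable (\<lambda>z. cnj (c z) * u z)"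
proof -
  obtain C where C: "\<And>z. z \<in> sphere 0 1 \<Longrightarrow> norm (c z) \<le> C"
    using continuous_bounded_circle[OF continuous_on_holomorphic_circle[OF c R]] by blast
  show ?thesis
    by (rule square_integrable_bounded_mult[OF
          measurable_cnj_circle[OF measurable_holomorphic_circle[OF c R]] _ u, of C]) (simp add: C)
qed

text \<open>
  The relation \<open>c(z) = a + z d(z)\<close> gives \<open>d(\<zeta>) + z Q(z, \<zeta>)\<close> for the difference quotient of \<open>c\<close>,
  where \<open>Q\<close> is the difference quotient of \<open>d\<close>. This is the recursion behind the induction on modes.
\<close>
lemma cauchy_commutator_cnj_shift:
  assumes c: "c holomorphic_on ball 0 R" and d: "d holomorphic_on ball 0 R" and R: "R > 1"
    and cd: "\<And>z. c z = a + z * d z" and u: "square_integrable u" and z: "z \<in> sphere 0 1"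
  shows "cauchy_commutator (\<lambda>z. cnj (c z)) u z =
    cnj z * (cauchy_commutator (\<lambda>z. cnj (d z)) u z - (LINT \<zeta>|circle_measure. cnj (d \<zeta>) * u \<zeta>))"
proof -
  obtain B where B:
    "(\<lambda>(z, \<zeta>). cnj (diff_quotient d z \<zeta>)) \<in> borel_measurable (circle_measure \<Otimes>\<^sub>M circle_measure)"
    "\<And>z \<zeta>. z \<in> sphere 0 1 \<Longrightarrow> \<zeta> \<in> sphere 0 1 \<Longrightarrow> norm (cnj (diff_quotient d z \<zeta>)) \<le> B"
    by (rule cnj_diff_quotient_kernel[OF d R]) blast
  note int1 = bounded_kernel_integrable[OF B z u]
  have d_meas: "d \<in> borel_measurable circle_measure" and c_meas: "c \<in> borel_measurable circle_measure"
    using measurable_holomorphic_circle c d R by auto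
  have int2: "integrable circle_measure (\<lambda>\<zeta>. cnj (d \<zeta>) * u \<zeta>)"
    by (rule square_integrable_imp_integrable[OF square_integrable_cnj_holomorphic_mult[OF d R u]])
  have "(LINT \<zeta>|circle_measure. cnj (diff_quotient c z \<zeta>) * u \<zeta>) =
     (LINT \<zeta>|circle_measure. cnj (d \<zeta>) * u \<zeta> + cnj z * (cnj (diff_quotient d z \<zeta>) * u \<zeta>))"
  proof (rule integral_cong_AE)
    note [measurable] = square_integrableD(1)[OF u]
      measurable_cnj_circle[OF measurable_diff_quotient1[OF c_meas]]
      measurable_cnj_circle[OF measurable_diff_quotient1[OF d_meas]]
      measurable_cnj_circle[OF d_meas]
    show "(\<lambda>\<zeta>. cnj (diff_quotient c z \<zeta>) * u \<zeta>) \<in> borel_measurable circle_measure"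
      "(\<lambda>\<zeta>. cnj (d \<zeta>) * u \<zeta> + cnj z * (cnj (diff_quotient d z \<zeta>) * u \<zeta>)) \<in> borel_measurable circle_measure"
      by measurable
    show "AE \<zeta> in circle_measure. cnj (diff_quotient c z \<zeta>) * u \<zeta> =
        cnj (d \<zeta>) * u \<zeta> + cnj z * (cnj (diff_quotient d z \<zeta>) * u \<zeta>)"
      using AE_circle_neq[of z]
    proof eventually_elim
      case (elim \<zeta>)
      then have "diff_quotient c z \<zeta> = d \<zeta> + z * diff_quotient d z \<zeta>"
        unfolding diff_quotient_def cd by (simp add: field_simps)
      then show ?case by (simp add: algebra_simps)
    qed
  qed
  also have "\<dots> = (LINT \<zeta>|circle_measure. cnj (d \<zeta>) * u \<zeta>) +
      cnj z * (LINT \<zeta>|circle_measure. cnj (diff_quotient d z \<zeta>) * u \<zeta>)"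
    using int1 int2 by simp
  finally show ?thesis
    by (simp add: cauchy_commutator_cnj[OF z] algebra_simps)
qed

text \<open>
  With \<open>S c = cnj c u + [C, cnj c] u\<close>, the shift relation reads
  \<open>S c = cnj (c 0) u + cnj z (S d - D)\<close>, where \<open>D\<close> is the mean of \<open>cnj d u\<close>. So mode \<open>-(n + 1)\<close> of \<open>S c\<close>
  is mode \<open>-n\<close> of \<open>S d - D\<close>. The induction starts because the commutator is orthogonal to
  constants, which makes \<open>D\<close> the mean of \<open>S d\<close> as well.
\<close>
lemma hardy_cauchy_commutator_cnj:
  assumes c: "c holomorphic_on ball 0 R" and R: "R > 1" and u: "hardy u"
  shows "hardy (\<lambda>z. cnj (c z) * u z + cauchy_commutator (\<lambda>z. cnj (c z)) u z)"
proof -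
  define S where "S = (\<lambda>c z. cnj (c z) * u z + cauchy_commutator (\<lambda>z. cnj (c z)) u z)"
  have sq: "square_integrable (S c)" if "c holomorphic_on ball 0 R" for c
    unfolding S_def
    using u by (intro square_integrable_add square_integrable_cauchy_commutator_cnj[OF that R]
        square_integrable_cnj_holomorphic_mult[OF that R] hardyD(1))
  have step: "\<exists>d D. d holomorphic_on ball 0 R \<and> D = (LINT \<zeta>|circle_measure. cnj (d \<zeta>) * u \<zeta>) \<and>
      (LINT z|circle_measure. z ^ Suc n * S c z) = (LINT z|circle_measure. z ^ n * (S d z - D))"
    if c: "c holomorphic_on ball 0 R" for n c
  proof -
    obtain d where d: "d holomorphic_on ball 0 R" and cd: "\<And>z. c z = c 0 + z * d z"
      by (rule holomorphic_split_at_0[OF c]) blast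
    define D where "D = (LINT \<zeta>|circle_measure. cnj (d \<zeta>) * u \<zeta>)"
    have "(LINT z|circle_measure. z ^ Suc n * S c z) =
        (LINT z|circle_measure. cnj (c 0) * (z ^ Suc n * u z) + z ^ n * (S d z - D))"
    proof (rule Bochner_Integration.integral_cong[OF refl])
      fix z assume "z \<in> space circle_measure"
      then have z: "z \<in> sphere 0 1" by simp
      then have zz: "z * cnj z = 1" by (simp add: complex_norm_square[symmetric])
      have "S c z = cnj (c 0) * u z + cnj z * (S d z - D)"
        unfolding S_def D_def cauchy_commutator_cnj_shift[OF c d R cd hardyD(1)[OF u] z]
        by (subst cd) (simp add: algebra_simps)
      then have "z ^ Suc n * S c z = z ^ Suc n * (cnj (c 0) * u z + cnj z * (S d z - D))"
        by (simp only:)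
      also have "\<dots> = cnj (c 0) * (z ^ Suc n * u z) + (z * cnj z) * (z ^ n * (S d z - D))"
        by (simp add: algebra_simps)
      finally have "z ^ Suc n * S c z = cnj (c 0) * (z ^ Suc n * u z) + (z * cnj z) * (z ^ n * (S d z - D))" .
      then show "z ^ Suc n * S c z = cnj (c 0) * (z ^ Suc n * u z) + z ^ n * (S d z - D)"
        by (simp only: zz mult_1_left)
    qed
    also have "\<dots> = cnj (c 0) * (LINT z|circle_measure. z ^ Suc n * u z) +
        (LINT z|circle_measure. z ^ n * (S d z - D))"
    proof (subst Bochner_Integration.integral_add)
      show "integrable circle_measure (\<lambda>z. cnj (c 0) * (z ^ Suc n * u z))"
        by (intro integrable_mult_right integrable_power_mult hardyD(1)[OF u])
      have "square_integrable (\<lambda>z. S d z + (- D))"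
        by (intro square_integrable_add sq[OF d] square_integrable_const)
      then show "integrable circle_measure (\<lambda>z. z ^ n * (S d z - D))"
        using integrable_power_mult by force
    qed (simp only: integral_mult_right_zero)
    also have "(LINT z|circle_measure. z ^ Suc n * u z) = 0"
      using hardyD(3)[OF u] by blast
    finally show ?thesis using d unfolding D_def by auto
  qed
  have zero: "(LINT z|circle_measure. z ^ Suc n * S c z) = 0" if "c holomorphic_on ball 0 R" for n c
    using that
  proof (induction n arbitrary: c)
    case (0 c)
    then obtain d D where d: "d holomorphic_on ball 0 R"
      and D: "D = (LINT \<zeta>|circle_measure. cnj (d \<zeta>) * u \<zeta>)"
      and eq: "(LINT z|circle_measure. z ^ Suc 0 * S c z) = (LINT z|circle_measure. z ^ 0 * (S d z - D))"
      using step[of c 0] by blast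
    have "(LINT z|circle_measure. cauchy_commutator (\<lambda>z. cnj (d z)) u z) = 0"
      using cauchy_commutator_cnj_orthogonal[OF d R hardyD(1)[OF u] hardy_const[of 1]] by simp
    then have "(LINT z|circle_measure. S d z) = D"
      unfolding S_def D
      by (subst Bochner_Integration.integral_add)
         (auto intro!: square_integrable_imp_integrable
            square_integrable_cauchy_commutator_cnj[OF d R hardyD(1)[OF u]]
            square_integrable_cnj_holomorphic_mult[OF d R hardyD(1)[OF u]])
    then show ?case
      unfolding eq using square_integrable_imp_integrable[OF sq[OF d]] circle.prob_space by simp
  next
    case (Suc n c)
    then obtain d D where d: "d holomorphic_on ball 0 R"
      and eq: "(LINT z|circle_measure. z ^ Suc (Suc n) * S c z) =
        (LINT z|circle_measure. z ^ Suc n * (S d z - D))"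
      using step[of c "Suc n"] by blast
    have "(LINT z|circle_measure. z ^ Suc n * (S d z - D)) =
        (LINT z|circle_measure. z ^ Suc n * S d z - z ^ Suc n * D)"
      by (simp only: right_diff_distrib)
    also have "\<dots> = (LINT z|circle_measure. z ^ Suc n * S d z) - (LINT z|circle_measure. z ^ Suc n * D)"
      by (intro Bochner_Integration.integral_diff integrable_power_mult sq[OF d] square_integrable_const)
    also have "(LINT z|circle_measure. z ^ Suc n * D) = 0"
      using hardyD(3)[OF hardy_const] by blast
    finally show ?case
      unfolding eq using Suc.IH[OF d] by simp
  qed
  have "hardy (S c)"
    unfolding hardy_def using sq[OF c] zero[OF c] by blast
  then show ?thesis by (simp add: S_def)
qed

section \<open>Splitting an analytic symbol\<close>

lemma cauchy_transform_holomorphic: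
  assumes f: "continuous_on (sphere 0 \<rho>) f" and \<rho>: "\<rho> > 0"
  shows "(\<lambda>z. contour_integral (circlepath 0 \<rho>) (\<lambda>w. f w / (w - z))) holomorphic_on - sphere 0 \<rho>"
proof -
  have int: "(\<lambda>w. f w / (w - z)) contour_integrable_on circlepath 0 \<rho>" if "z \<notin> sphere 0 \<rho>" for z
    by (rule contour_integrable_continuous_circlepath)
       (use f \<rho> that in \<open>auto intro!: continuous_intros\<close>)
  have "\<exists>D. ((\<lambda>z. contour_integral (circlepath 0 \<rho>) (\<lambda>w. f w / (w - z))) has_field_derivative D) (at z)"
    if z: "z \<in> - sphere 0 \<rho>" for z
  proof -
    have "((\<lambda>z. contour_integral (circlepath 0 \<rho>) (\<lambda>w. f w / (w - z))) has_field_derivative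
        of_nat 1 * contour_integral (circlepath 0 \<rho>) (\<lambda>w. f w / (w - z) ^ Suc 1)) (at z)"
      by (rule Cauchy_next_derivative(2)[where S=UNIV and B="2 * pi * \<rho>"])
         (use f \<rho> z int in \<open>auto simp: vector_derivative_circlepath norm_mult
            intro!: has_contour_integral_integral\<close>)
    then show ?thesis by blast
  qed
  then show ?thesis
    by (subst holomorphic_on_open) auto
qed

text \<open>Inversion turns a bounded neighbourhood of infinity into a removable singularity at 0.\<close>
lemma holomorphic_at_infinity:
  fixes b :: "complex \<Rightarrow> complex"
  assumes b: "b holomorphic_on - cball 0 r" and r: "r > 0"
    and bound: "\<And>z. norm z \<ge> 2 * r \<Longrightarrow> norm (b z) \<le> C"
  obtains \<beta> where "\<beta> holomorphic_on ball 0 (1 / r)" "\<And>z. norm z > r \<Longrightarrow> \<beta> (1 / z) = b z"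
proof -
  have "(\<lambda>x. b (1 / x)) holomorphic_on ball 0 (1 / r) - {0}"
  proof (rule holomorphic_on_compose_gen[OF _ b, unfolded o_def])
    show "(\<lambda>x. 1 / x) holomorphic_on ball 0 (1 / r) - {0}"
      by (intro holomorphic_intros) auto
    show "(\<lambda>x. 1 / x) ` (ball 0 (1 / r) - {0}) \<subseteq> - cball (0::complex) r"
    proof (rule image_subsetI)
      fix x :: complex assume "x \<in> ball 0 (1 / r) - {0}"
      then have "0 < norm x" "norm x < 1 / r" by (simp_all add: mem_ball_0)
      then have "r < norm (1 / x)" using r by (simp add: norm_divide field_simps)
      then show "1 / x \<in> - cball 0 r" unfolding Compl_iff mem_cball_0 by simp
    qed
  qed
  moreover have "norm (b (1 / x)) \<le> C" if "x \<noteq> 0" "dist x 0 < 1 / (2 * r)" for x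
  proof -
    have "0 < norm x" "norm x < 1 / (2 * r)" using that by simp_all
    then have "2 * r \<le> norm (1 / x)" using r by (simp add: norm_divide field_simps)
    then show "norm (b (1 / x)) \<le> C" by (rule bound)
  qed
  then have "\<forall>\<^sub>F x in at 0. norm (b (1 / x)) \<le> C"
    unfolding eventually_at using r by (intro exI[of _ "1 / (2 * r)"]) auto
  ultimately obtain \<beta> where \<beta>: "\<beta> holomorphic_on ball 0 (1 / r)"
      "\<And>x. x \<in> ball 0 (1 / r) - {0} \<Longrightarrow> \<beta> x = b (1 / x)"
    using holomorphic_on_extend_bounded[of "\<lambda>x. b (1 / x)" "ball 0 (1 / r)" 0] r by auto
  have "\<beta> (1 / z) = b z" if "norm z > r" for z
  proof -
    have "z \<noteq> 0" using that r by auto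
    have "0 < norm z" using that r by linarith
    then have "norm (1 / z) < 1 / r" using that r by (simp add: norm_divide field_simps)
    then have "1 / z \<in> ball 0 (1 / r) - {0}" unfolding Diff_iff mem_ball_0 using \<open>z \<noteq> 0\<close> by simp
    from \<beta>(2)[OF this] show ?thesis by simp
  qed
  with \<beta>(1) show thesis by (intro that)
qed

lemma annulus_neighbourhood:
  assumes "open U" "sphere 0 1 \<subseteq> (U :: complex set)"
  obtains e where "0 < e" "e \<le> 1" "\<And>z. \<bar>norm z - 1\<bar> < e \<Longrightarrow> z \<in> U"
proof -
  obtain e where e: "e > 0" "(\<Union>x\<in>sphere 0 1. ball x e) \<subseteq> U"
    by (rule compact_subset_open_imp_ball_epsilon_subset[OF _ assms]) auto
  have "z \<in> U" if z: "\<bar>norm z - 1\<bar> < min e 1" for z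
  proof -
    have nz: "norm z \<noteq> 0" using z by auto
    \<comment> \<open>The nearest point of the circle is the radial projection.\<close>
    have "z - z / norm z = (norm z - 1) *\<^sub>R (z / norm z)"
      using nz by (simp add: scaleR_conv_of_real field_simps)
    then have "norm (z - z / norm z) = \<bar>norm z - 1\<bar>"
      using nz by (simp add: norm_divide)
    then have "z \<in> ball (z / norm z) e" using z by (simp add: dist_norm norm_minus_commute)
    moreover have "z / norm z \<in> sphere 0 1" using nz by (simp add: norm_divide)
    ultimately show ?thesis using e(2) by blast
  qed
  then show thesis using e(1) by (intro that[of "min e 1"]) auto
qed

lemma homotopic_circlepaths:
  assumes "0 < r" "r \<le> s" "\<And>z. r \<le> norm z \<Longrightarrow> norm z \<le> s \<Longrightarrow> z \<in> W"
  shows "homotopic_loops W (circlepath 0 s) (circlepath 0 r)"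
proof (rule homotopic_loops_linear)
  fix t x :: real
  show "closed_segment (circlepath 0 s t) (circlepath 0 r t) \<subseteq> W"
  proof
    fix y assume "y \<in> closed_segment (circlepath 0 s t) (circlepath 0 r t)"
    then obtain v where v: "0 \<le> v" "v \<le> 1"
      and y: "y = (1 - v) *\<^sub>R circlepath 0 s t + v *\<^sub>R circlepath 0 r t"
      by (auto simp: closed_segment_def)
    have "y = ((1 - v) * s + v * r) *\<^sub>R exp (2 * of_real pi * \<i> * of_real t)"
      unfolding y circlepath by (simp add: scaleR_conv_of_real algebra_simps)
    then have ny: "norm y = \<bar>(1 - v) * s + v * r\<bar>"
      by simp
    have "(1 - v) * r + v * r \<le> (1 - v) * s + v * r"
      using v assms(2) by (intro add_mono mult_left_mono) auto
    moreover have "(1 - v) * s + v * r \<le> (1 - v) * s + v * s"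
      using v assms(2) by (intro add_mono mult_left_mono) auto
    moreover have "(1 - v) * r + v * r = r" "(1 - v) * s + v * s = s"
      by (simp_all add: algebra_simps)
    ultimately have "r \<le> norm y" "norm y \<le> s"
      using ny assms(1) by linarith+
    then show "y \<in> W" by (rule assms(3))
  qed
qed auto

lemma contour_integral_difference_quotient:
  assumes "continuous_on (sphere 0 \<rho>) a" "\<rho> > 0" "z \<notin> sphere 0 \<rho>"
    and "\<And>w. w \<in> sphere 0 \<rho> \<Longrightarrow> q w = (a w - a z) / (w - z)"
  shows "contour_integral (circlepath 0 \<rho>) q =
    contour_integral (circlepath 0 \<rho>) (\<lambda>w. a w / (w - z)) -
    a z * contour_integral (circlepath 0 \<rho>) (\<lambda>w. 1 / (w - z))"
proof -
  have int: "(\<lambda>w. f w / (w - z)) contour_integrable_on circlepath 0 \<rho>"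
    if "continuous_on (sphere 0 \<rho>) f" for f
    by (rule contour_integrable_continuous_circlepath)
       (use that assms in \<open>auto intro!: continuous_intros\<close>)
  have "contour_integral (circlepath 0 \<rho>) q =
      contour_integral (circlepath 0 \<rho>) (\<lambda>w. a w / (w - z) - a z * (1 / (w - z)))"
    by (rule contour_integral_eq) (use assms in \<open>auto simp: diff_divide_distrib\<close>)
  also have "\<dots> = contour_integral (circlepath 0 \<rho>) (\<lambda>w. a w / (w - z)) -
      contour_integral (circlepath 0 \<rho>) (\<lambda>w. a z * (1 / (w - z)))"
    by (intro contour_integral_diff contour_integrable_lmul int assms continuous_intros)
  also have "contour_integral (circlepath 0 \<rho>) (\<lambda>w. a z * (1 / (w - z))) =
      a z * contour_integral (circlepath 0 \<rho>) (\<lambda>w. 1 / (w - z))"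
    by (intro contour_integral_lmul int continuous_intros)
  finally show ?thesis .
qed

text \<open>
  The difference quotient of \<open>a\<close> at \<open>z\<close> extends holomorphically to \<open>W\<close>, so its integrals over the
  two homotopic circles agree. Splitting them, the terms with \<open>a z\<close> differ because only the outer
  circle winds around \<open>z\<close>.
\<close>
lemma Cauchy_annulus:
  assumes a: "a holomorphic_on W" and W: "open W"
    and r: "0 < r" and rs: "\<And>z. r \<le> norm z \<Longrightarrow> norm z \<le> s \<Longrightarrow> z \<in> W"
    and z: "r < norm z" "norm z < s"
  shows "2 * complex_of_real pi * \<i> * a z =
    contour_integral (circlepath 0 s) (\<lambda>w. a w / (w - z)) -
    contour_integral (circlepath 0 r) (\<lambda>w. a w / (w - z))"
proof -
  define q where "q = (\<lambda>w. if w = z then deriv a z else (a w - a z) / (w - z))"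
  have q: "q holomorphic_on W"
    unfolding q_def by (rule pole_lemma_open[OF a W])
  have s: "0 < s" "r \<le> s" using r z by linarith+
  have cont: "continuous_on (sphere 0 \<rho>) a" if "\<rho> = r \<or> \<rho> = s" for \<rho>
    by (rule continuous_on_subset[OF holomorphic_on_imp_continuous_on[OF a]])
       (use that rs s in auto)
  have "contour_integral (circlepath 0 s) q = contour_integral (circlepath 0 r) q"
    by (rule Cauchy_theorem_homotopic_loops[OF homotopic_circlepaths[OF r s(2) rs] W q]) auto
  moreover have "contour_integral (circlepath 0 s) q =
      contour_integral (circlepath 0 s) (\<lambda>w. a w / (w - z)) -
      a z * contour_integral (circlepath 0 s) (\<lambda>w. 1 / (w - z))"
    by (rule contour_integral_difference_quotient) (use cont s z in \<open>auto simp: q_def\<close>)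
  moreover have "contour_integral (circlepath 0 r) q =
      contour_integral (circlepath 0 r) (\<lambda>w. a w / (w - z)) -
      a z * contour_integral (circlepath 0 r) (\<lambda>w. 1 / (w - z))"
    by (rule contour_integral_difference_quotient) (use cont r z in \<open>auto simp: q_def\<close>)
  moreover have "contour_integral (circlepath 0 s) (\<lambda>w. 1 / (w - z)) = 2 * complex_of_real pi * \<i>"
    using Cauchy_integral_circlepath_simple[of "\<lambda>_. 1" 0 s z] z
    by (auto intro!: contour_integral_unique)
  moreover have "contour_integral (circlepath 0 r) (\<lambda>w. 1 / (w - z)) = 0"
  proof (rule contour_integral_unique, rule Cauchy_theorem_disc_simple[of _ 0 "norm z"])
    show "(\<lambda>w. 1 / (w - z)) holomorphic_on ball 0 (norm z)"
      by (intro holomorphic_intros) auto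
  qed (use r z in auto)
  ultimately show ?thesis
    by (simp add: algebra_simps)
qed

text \<open>
  Cauchy's formula on a thin annulus represents \<open>a\<close> as a Cauchy integral over the outer circle,
  holomorphic inside it, minus one over the inner circle, holomorphic outside it and at
  infinity. On the unit circle the latter is a function of \<open>1/z\<close>, that is of \<open>cnj z\<close>, and is
  therefore the conjugate of a function holomorphic on a disc.
\<close>
lemma circle_symbol_splitting:
  assumes U: "open U" "sphere 0 1 \<subseteq> U" and a: "a holomorphic_on U"
  obtains g c R where "R > 1" "g holomorphic_on ball 0 R" "c holomorphic_on ball 0 R"
    "\<And>z. z \<in> sphere 0 1 \<Longrightarrow> a z = g z + cnj (c z)"
proof -
  obtain e where e: "0 < e" "e \<le> 1" "\<And>z. \<bar>norm z - 1\<bar> < e \<Longrightarrow> z \<in> U"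
    using annulus_neighbourhood[OF U] by blast
  define r where "r = 1 - e / 2"
  define s where "s = 1 + e / 2"
  have rs: "0 < r" "r < 1" "1 < s" using e by (auto simp: r_def s_def)
  have inU: "z \<in> U" if "r \<le> norm z" "norm z \<le> s" for z
    using that e by (auto simp: r_def s_def)
  have cont: "continuous_on (sphere 0 \<rho>) a" if "\<rho> = r \<or> \<rho> = s" for \<rho>
    by (rule continuous_on_subset[OF holomorphic_on_imp_continuous_on[OF a]])
       (use that rs inU in auto)
  define F where "F = (\<lambda>\<rho> z. contour_integral (circlepath 0 \<rho>) (\<lambda>w. a w / (w - z)))"
  have F: "F \<rho> holomorphic_on - sphere 0 \<rho>" if "\<rho> = r \<or> \<rho> = s" for \<rho>
    unfolding F_def by (rule cauchy_transform_holomorphic) (use cont that rs in auto)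
  have "compact (a ` sphere 0 r)"
    by (intro compact_continuous_image cont) auto
  then obtain C where C: "C > 0" "\<And>w. w \<in> sphere 0 r \<Longrightarrow> norm (a w) \<le> C"
    by (auto dest!: compact_imp_bounded simp: bounded_pos)
  have bound: "norm (F r z) \<le> C / r * (2 * pi * r)" if "norm z \<ge> 2 * r" for z
  proof (rule has_contour_integral_bound_circlepath[of "\<lambda>w. a w / (w - z)" _ 0])
    show "((\<lambda>w. a w / (w - z)) has_contour_integral F r z) (circlepath 0 r)"
      unfolding F_def
      by (intro has_contour_integral_integral contour_integrable_continuous_circlepath)
         (use cont rs that in \<open>auto intro!: continuous_intros\<close>)
    fix x :: complex assume x: "norm (x - 0) = r"
    then have "r \<le> norm (x - z)"
      using norm_triangle_ineq2[of z x] that by (simp add: norm_minus_commute)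
    then show "norm (a x / (x - z)) \<le> C / r"
      unfolding norm_divide using C x rs by (intro frac_le) auto
  qed (use C rs in auto)
  have "F r holomorphic_on - cball 0 r"
    by (rule holomorphic_on_subset[OF F]) auto
  then obtain \<beta> where \<beta>: "\<beta> holomorphic_on ball 0 (1 / r)" "\<And>z. norm z > r \<Longrightarrow> \<beta> (1 / z) = F r z"
    by (rule holomorphic_at_infinity[OF _ rs(1) bound]) blast+
  define R where "R = min s (1 / r)"
  define k where "k = 1 / (2 * complex_of_real pi * \<i>)"
  show thesis
  proof (rule that[of R "\<lambda>z. k * F s z" "\<lambda>z. cnj (- k * \<beta> (cnj z))"])
    show "R > 1" using rs by (auto simp: R_def)
    show "(\<lambda>z. k * F s z) holomorphic_on ball 0 R"
      by (intro holomorphic_intros holomorphic_on_subset[OF F]) (auto simp: R_def)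
    have "cnj ` ball 0 R \<subseteq> ball 0 (1 / r)" by (auto simp: R_def)
    then have "(\<lambda>x. - k * \<beta> x) holomorphic_on cnj ` ball 0 R"
      by (intro holomorphic_intros holomorphic_on_subset[OF \<beta>(1)])
    from holomorphic_on_compose_cnj_cnj[OF this open_ball]
    show "(\<lambda>z. cnj (- k * \<beta> (cnj z))) holomorphic_on ball 0 R"
      by (simp add: o_def)
    fix z :: complex assume z: "z \<in> sphere 0 1"
    have "2 * complex_of_real pi * \<i> * a z = F s z - F r z"
      unfolding F_def by (rule Cauchy_annulus[OF a U(1) rs(1) inU]) (use z rs in auto)
    then have "a z = k * (F s z - F r z)"
      by (simp add: k_def field_simps)
    \<comment> \<open>\<open>\<beta>\<close> describes the inner Cauchy integral in the coordinate \<open>1/z\<close>, which is \<open>cnj z\<close> here.\<close>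
    also have "F r z = \<beta> (cnj z)"
      using \<beta>(2)[of z] z rs by (simp add: circle_cnj_eq)
    finally show "a z = k * F s z + cnj (cnj (- k * \<beta> (cnj z)))"
      by (simp add: algebra_simps)
  qed
qed

section \<open>Analytic symbols acting on Hardy functions\<close>

definition circle_analytic :: "(complex \<Rightarrow> complex) \<Rightarrow> bool" where
  "circle_analytic a \<longleftrightarrow>
     (\<exists>U A. open U \<and> sphere 0 1 \<subseteq> U \<and> A holomorphic_on U \<and> (\<forall>z\<in>sphere 0 1. A z = a z))"

lemma circle_analytic_continuous:
  assumes "circle_analytic a" shows "continuous_on (sphere 0 1) a"
proof -
  obtain U A where "sphere 0 1 \<subseteq> U" "A holomorphic_on U" and eq: "\<And>z. z \<in> sphere 0 1 \<Longrightarrow> A z = a z"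
    using assms unfolding circle_analytic_def by blast
  then have "continuous_on (sphere 0 1) A"
    by (blast intro: continuous_on_subset holomorphic_on_imp_continuous_on)
  then show ?thesis by (rule continuous_on_eq) (rule eq)
qed

lemma circle_analytic_measurable:
  "circle_analytic a \<Longrightarrow> a \<in> borel_measurable circle_measure"
  by (intro continuous_on_imp_measurable_circle circle_analytic_continuous)

lemma square_integrable_circle_analytic_mult:
  assumes a: "circle_analytic a" and u: "square_integrable u"
  shows "square_integrable (\<lambda>z. a z * u z)"
proof -
  obtain C where C: "\<And>z. z \<in> sphere 0 1 \<Longrightarrow> norm (a z) \<le> C"
    using continuous_bounded_circle[OF circle_analytic_continuous[OF a]] by blast
  show ?thesis
    by (rule square_integrable_bounded_mult[OF circle_analytic_measurable[OF a] C u])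
qed

lemma hardy_cong:
  assumes "\<And>z. z \<in> sphere 0 1 \<Longrightarrow> u z = v z"
  shows "hardy u \<longleftrightarrow> hardy v"
proof -
  have "(LINT z|circle_measure. z ^ Suc n * u z) = (LINT z|circle_measure. z ^ Suc n * v z)" for n
    by (rule Bochner_Integration.integral_cong[OF refl]) (simp add: assms)
  moreover have "square_integrable u \<longleftrightarrow> square_integrable v"
    by (rule square_integrable_cong) (rule assms)
  ultimately show ?thesis
    unfolding hardy_def by (simp only:)
qed

lemma hardy_add:
  assumes u: "hardy u" and v: "hardy v"
  shows "hardy (\<lambda>z. u z + v z)"
proof (rule hardyI)
  show "square_integrable (\<lambda>z. u z + v z)"
    by (intro square_integrable_add hardyD(1)[OF u] hardyD(1)[OF v])
  show "(LINT z|circle_measure. z ^ n * (u z + v z)) = 0" if "n > 0" for n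
    using hardyD(3)[OF u that] hardyD(3)[OF v that]
      integrable_power_mult[OF hardyD(1)[OF u], of n] integrable_power_mult[OF hardyD(1)[OF v], of n]
    by (simp add: distrib_left)
qed

lemma hardy_uminus: "hardy u \<Longrightarrow> hardy (\<lambda>z. - u z)"
  by (rule hardyI) (auto dest: hardyD(1,3) simp: square_integrable_uminus)

lemma hardy_holomorphic_mult:
  assumes g: "g holomorphic_on ball 0 R" and R: "R > 1" and u: "hardy u"
  shows "hardy (\<lambda>z. g z * u z)"
proof (rule hardyI)
  obtain C where C: "\<And>z. z \<in> sphere 0 1 \<Longrightarrow> norm (g z) \<le> C"
    using continuous_bounded_circle[OF continuous_on_holomorphic_circle[OF g R]] by blast
  show "square_integrable (\<lambda>z. g z * u z)"
    by (rule square_integrable_bounded_mult[OF measurable_holomorphic_circle[OF g R] C hardyD(1)[OF u]])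
qed (rule integral_holomorphic_mult_hardy[OF g R u])

text \<open>
  The last two conclusions say that \<open>a u + [C, a] u\<close> is the orthogonal projection of \<open>a u\<close> to the
  Hardy functions. After splitting \<open>a = g + cnj c\<close> the commutator with \<open>g\<close> vanishes, so everything
  reduces to the conjugate part.
\<close>
lemma
  assumes a: "circle_analytic a" and u: "hardy u"
  shows integrable_cauchy_commutator: "z \<in> sphere 0 1 \<Longrightarrow>
      integrable circle_measure (\<lambda>\<zeta>. \<zeta> * (diff_quotient a z \<zeta> * u \<zeta>))"
    and square_integrable_cauchy_commutator: "square_integrable (cauchy_commutator a u)"
    and hardy_cauchy_commutator: "hardy (\<lambda>z. a z * u z + cauchy_commutator a u z)"
    and cauchy_commutator_orthogonal: "hardy h \<Longrightarrow>
      (LINT z|circle_measure. cauchy_commutator a u z * cnj (h z)) = 0"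
proof -
  obtain U A where U: "open U" "sphere 0 1 \<subseteq> U" and A: "A holomorphic_on U"
    and Aa: "\<And>z. z \<in> sphere 0 1 \<Longrightarrow> A z = a z"
    using a unfolding circle_analytic_def by blast
  obtain g c R where R: "R > 1" and g: "g holomorphic_on ball 0 R" and c: "c holomorphic_on ball 0 R"
    and split: "\<And>z. z \<in> sphere 0 1 \<Longrightarrow> A z = g z + cnj (c z)"
    by (rule circle_symbol_splitting[OF U A]) blast
  note u2 = hardyD(1)[OF u]
  have diff_quotient_split: "\<zeta> * (diff_quotient a z \<zeta> * u \<zeta>) =
      \<zeta> * (diff_quotient g z \<zeta> * u \<zeta>) + \<zeta> * (diff_quotient (\<lambda>z. cnj (c z)) z \<zeta> * u \<zeta>)"
    if "z \<in> sphere 0 1" "\<zeta> \<in> sphere 0 1" for z \<zeta>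
    unfolding diff_quotient_def using that
    by (simp add: Aa[symmetric] split add_divide_distrib[symmetric] distrib_left[symmetric]
        distrib_right[symmetric])
  obtain B where B: "\<And>z \<zeta>. z \<in> sphere 0 1 \<Longrightarrow> \<zeta> \<in> sphere 0 1 \<Longrightarrow> norm (diff_quotient g z \<zeta>) \<le> B"
    by (rule diff_quotient_bounded[OF g R]) blast
  have int1: "integrable circle_measure (\<lambda>\<zeta>. \<zeta> * (diff_quotient g z \<zeta> * u \<zeta>))" if "z \<in> sphere 0 1" for z
    using integrable_power_mult[OF square_integrable_bounded_mult[OF
        measurable_diff_quotient1[OF measurable_holomorphic_circle[OF g R]] B[OF that] u2], of 1]
    by simp
  obtain B' where B':
    "(\<lambda>(z, \<zeta>). cnj (diff_quotient c z \<zeta>)) \<in> borel_measurable (circle_measure \<Otimes>\<^sub>M circle_measure)"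
    "\<And>z \<zeta>. z \<in> sphere 0 1 \<Longrightarrow> \<zeta> \<in> sphere 0 1 \<Longrightarrow> norm (cnj (diff_quotient c z \<zeta>)) \<le> B'"
    by (rule cnj_diff_quotient_kernel[OF c R]) blast
  have int2: "integrable circle_measure (\<lambda>\<zeta>. \<zeta> * (diff_quotient (\<lambda>z. cnj (c z)) z \<zeta> * u \<zeta>))"
    if z: "z \<in> sphere 0 1" for z
  proof -
    have "integrable circle_measure (\<lambda>\<zeta>. - cnj z * (cnj (diff_quotient c z \<zeta>) * u \<zeta>))"
      by (intro integrable_mult_right bounded_kernel_integrable[OF B' z u2])
    then show ?thesis
      by (rule Bochner_Integration.integrable_cong[THEN iffD1, OF refl, rotated])
         (use diff_quotient_cnj[OF z] in \<open>simp add: mult.assoc[symmetric]\<close>)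
  qed
  show int: "integrable circle_measure (\<lambda>\<zeta>. \<zeta> * (diff_quotient a z \<zeta> * u \<zeta>))" if z: "z \<in> sphere 0 1" for z
    by (rule Bochner_Integration.integrable_cong[THEN iffD2, OF refl _
          Bochner_Integration.integrable_add[OF int1[OF z] int2[OF z]]])
       (use diff_quotient_split[OF z] in simp)
  have comm: "cauchy_commutator a u z = cauchy_commutator (\<lambda>z. cnj (c z)) u z"
    if z: "z \<in> sphere 0 1" for z
  proof -
    have "cauchy_commutator a u z = (LINT \<zeta>|circle_measure.
        \<zeta> * (diff_quotient g z \<zeta> * u \<zeta>) + \<zeta> * (diff_quotient (\<lambda>z. cnj (c z)) z \<zeta> * u \<zeta>))"
      unfolding cauchy_commutator_def
      by (rule Bochner_Integration.integral_cong[OF refl]) (use diff_quotient_split[OF z] in simp)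
    also have "\<dots> = (LINT \<zeta>|circle_measure. \<zeta> ^ 1 * (diff_quotient g z \<zeta> * u \<zeta>)) +
        cauchy_commutator (\<lambda>z. cnj (c z)) u z"
      unfolding cauchy_commutator_def using int1[OF z] int2[OF z] by simp
    also have "(LINT \<zeta>|circle_measure. \<zeta> ^ 1 * (diff_quotient g z \<zeta> * u \<zeta>)) = 0"
      by (rule diff_quotient_holomorphic_mult_hardy[OF g R u zero_less_one])
    finally show ?thesis by simp
  qed
  show "square_integrable (cauchy_commutator a u)"
    using square_integrable_cauchy_commutator_cnj[OF c R u2]
    by (rule square_integrable_cong[THEN iffD1, rotated]) (rule comm[symmetric])
  have "hardy (\<lambda>z. g z * u z + (cnj (c z) * u z + cauchy_commutator (\<lambda>z. cnj (c z)) u z))"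
    by (intro hardy_add hardy_holomorphic_mult[OF g R u] hardy_cauchy_commutator_cnj[OF c R u])
  then show "hardy (\<lambda>z. a z * u z + cauchy_commutator a u z)"
    by (rule hardy_cong[THEN iffD1, rotated])
       (simp add: comm Aa[symmetric] split algebra_simps)
  have "(LINT z|circle_measure. cauchy_commutator a u z * cnj (h z)) =
      (LINT z|circle_measure. cauchy_commutator (\<lambda>z. cnj (c z)) u z * cnj (h z))"
    by (rule Bochner_Integration.integral_cong[OF refl]) (simp add: comm)
  then show "(LINT z|circle_measure. cauchy_commutator a u z * cnj (h z)) = 0" if "hardy h"
    using cauchy_commutator_cnj_orthogonal[OF c R u2 that] by simp
qed

section \<open>Vector-valued functions and the projection\<close>

lemma measurable_vec_nth:
  fixes f :: "'a \<Rightarrow> complex ^ 'n"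
  assumes "f \<in> borel_measurable M" shows "(\<lambda>z. f z $ i) \<in> borel_measurable M"
  by (rule measurable_compose[OF assms borel_measurable_continuous_onI])
     (intro continuous_intros)

lemma bounded_linear_axis: "bounded_linear (axis i :: complex \<Rightarrow> complex ^ 'n)"
proof -
  have "linear (axis i :: complex \<Rightarrow> complex ^ 'n)"
    by (rule linearI) (auto simp: axis_def vec_eq_iff)
  then show ?thesis by (simp add: linear_conv_bounded_linear)
qed

lemma vec_eq_sum_axis: "(x :: complex ^ 'n) = (\<Sum>i\<in>UNIV. axis i (x $ i))"
  by (simp add: vec_eq_iff axis_def if_distrib cong: if_cong)

lemma measurable_vec:
  fixes f :: "'a \<Rightarrow> complex ^ 'n"
  assumes "\<And>i. (\<lambda>z. f z $ i) \<in> borel_measurable M"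
  shows "f \<in> borel_measurable M"
proof -
  have "(\<lambda>z. \<Sum>i\<in>UNIV. axis i (f z $ i)) \<in> borel_measurable M"
    by (intro borel_measurable_sum measurable_compose[OF assms borel_measurable_continuous_onI]
        linear_continuous_on bounded_linear_axis)
  then show ?thesis by (simp add: vec_eq_sum_axis[symmetric])
qed

lemma integrable_vec:
  fixes f :: "'a \<Rightarrow> complex ^ 'n"
  assumes "\<And>i. integrable M (\<lambda>z. f z $ i)"
  shows "integrable M f"
proof -
  have "integrable M (\<lambda>z. \<Sum>i\<in>UNIV. axis i (f z $ i))"
    by (intro Bochner_Integration.integrable_sum integrable_bounded_linear[OF bounded_linear_axis] assms)
  then show ?thesis by (simp add: vec_eq_sum_axis[symmetric])
qed

lemma norm_vec_power2: "(norm (x :: complex ^ 'n))\<^sup>2 = (\<Sum>i\<in>UNIV. (norm (x $ i))\<^sup>2)"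
  by (simp add: norm_vec_def L2_set_def sum_nonneg)

lemma L2_circle_iff:
  fixes f :: "complex \<Rightarrow> complex ^ 'n"
  shows "f \<in> L2_circle \<longleftrightarrow> (\<forall>i. square_integrable (\<lambda>z. f z $ i))"
proof
  assume f: "f \<in> L2_circle"
  show "\<forall>i. square_integrable (\<lambda>z. f z $ i)"
  proof
    fix i
    have meas: "(\<lambda>z. f z $ i) \<in> borel_measurable circle_measure"
      using f by (auto simp: L2_circle_def intro: measurable_vec_nth)
    have "integrable circle_measure (\<lambda>z. (norm (f z))\<^sup>2)"
      using f by (simp add: L2_circle_def)
    then have "integrable circle_measure (\<lambda>z. (norm (f z $ i))\<^sup>2)"
      by (rule Bochner_Integration.integrable_bound)
         (use meas in \<open>auto intro!: power_mono component_le_norm_cart Finite_Cartesian_Product.norm_nth_le\<close>)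
    with meas show "square_integrable (\<lambda>z. f z $ i)" by (simp add: square_integrable_def)
  qed
next
  assume f: "\<forall>i. square_integrable (\<lambda>z. f z $ i)"
  then have "f \<in> borel_measurable circle_measure"
    by (intro measurable_vec) (simp add: square_integrable_def)
  moreover have "integrable circle_measure (\<lambda>z. (norm (f z))\<^sup>2)"
    unfolding norm_vec_power2
    by (rule Bochner_Integration.integrable_sum) (use f in \<open>simp add: square_integrable_def\<close>)
  ultimately show "f \<in> L2_circle" by (simp add: L2_circle_def)
qed

lemma fourier_coeff_neg_nth:
  fixes f :: "complex \<Rightarrow> complex ^ 'n"
  assumes "f \<in> L2_circle"
  shows "fourier_coeff f (- int n) $ i = (LINT z|circle_measure. z ^ n * f z $ i)"
proof -
  have "integrable circle_measure (\<lambda>z. z ^ n *s f z)"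
    by (rule integrable_vec) (use assms in \<open>auto simp: L2_circle_iff intro: integrable_power_mult\<close>)
  then have "(LINT z|circle_measure. (z ^ n *s f z)) $ i = (LINT z|circle_measure. (z ^ n *s f z) $ i)"
    by (rule integral_bounded_linear[OF bounded_linear_vec_nth, symmetric])
  then show ?thesis by (simp add: fourier_coeff_def)
qed

lemma H_plus_iff:
  fixes f :: "complex \<Rightarrow> complex ^ 'n"
  shows "f \<in> H_plus \<longleftrightarrow> (\<forall>i. hardy (\<lambda>z. f z $ i))"
proof (cases "f \<in> L2_circle")
  case True
  have "f \<in> H_plus \<longleftrightarrow> (\<forall>n. fourier_coeff f (- int (Suc n)) = 0)"
    unfolding H_plus_def using True
  proof (safe, goal_cases)
    case (2 k)
    then show ?case by (cases k rule: int_cases) (auto simp del: of_nat_Suc)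
  qed auto
  also have "\<dots> \<longleftrightarrow> (\<forall>i. hardy (\<lambda>z. f z $ i))"
    using True unfolding hardy_def L2_circle_iff[THEN iffD1, OF True, rule_format]
    by (auto simp: vec_eq_iff fourier_coeff_neg_nth[OF True] L2_circle_iff simp del: of_nat_Suc power_Suc)
  finally show ?thesis .
qed (auto simp: H_plus_def hardy_def L2_circle_iff)

lemma L2_circle_measurable: "f \<in> L2_circle \<Longrightarrow> f \<in> borel_measurable circle_measure"
  by (simp add: L2_circle_def)

lemma H_plus_L2: "f \<in> H_plus \<Longrightarrow> f \<in> L2_circle"
  by (simp add: H_plus_def)

lemma L2_circle_diff: "f \<in> L2_circle \<Longrightarrow> g \<in> L2_circle \<Longrightarrow> (\<lambda>z. f z - g z) \<in> L2_circle"
  unfolding L2_circle_iff vector_minus_component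
  using square_integrable_add[OF _ square_integrable_uminus] by fastforce

lemma H_plus_diff: "f \<in> H_plus \<Longrightarrow> g \<in> H_plus \<Longrightarrow> (\<lambda>z. f z - g z) \<in> H_plus"
  unfolding H_plus_iff vector_minus_component
  using hardy_add[OF _ hardy_uminus] by fastforce

lemma L2_inner_eq_sum:
  assumes "f \<in> L2_circle" "g \<in> L2_circle"
  shows "L2_inner f g = (\<Sum>i\<in>UNIV. LINT z|circle_measure. f z $ i * cnj (g z $ i))"
  unfolding L2_inner_def
  by (rule Bochner_Integration.integral_sum)
     (use assms in \<open>simp add: L2_circle_iff integrable_mult_square_integrable square_integrable_cnj\<close>)

lemma L2_inner_diff_left:
  assumes "f \<in> L2_circle" "g \<in> L2_circle" "h \<in> L2_circle"
  shows "L2_inner (\<lambda>z. f z - g z) h = L2_inner f h - L2_inner g h"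
proof -
  have int: "integrable circle_measure (\<lambda>z. f z $ i * cnj (h z $ i))"
    if "f \<in> L2_circle" for f i
    using that assms(3)
    by (simp add: L2_circle_iff integrable_mult_square_integrable square_integrable_cnj)
  show ?thesis
    unfolding L2_inner_eq_sum[OF assms(1,3)] L2_inner_eq_sum[OF assms(2,3)]
      L2_inner_eq_sum[OF L2_circle_diff[OF assms(1,2)] assms(3)]
    by (simp add: left_diff_distrib Bochner_Integration.integral_diff[OF int int] assms sum_subtractf)
qed

lemma L2_inner_self_zero:
  assumes f: "f \<in> L2_circle" and zero: "L2_inner f f = 0"
  shows "AE z in circle_measure. f z = 0"
proof -
  have "L2_inner f f = (LINT z|circle_measure. of_real ((norm (f z))\<^sup>2))"
    unfolding L2_inner_def norm_vec_power2 by (simp only: of_real_sum complex_norm_square)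
  also have "\<dots> = of_real (LINT z|circle_measure. (norm (f z))\<^sup>2)"
    by (rule integral_complex_of_real)
  finally have "(LINT z|circle_measure. (norm (f z))\<^sup>2) = 0"
    using zero by simp
  moreover have "integrable circle_measure (\<lambda>z. (norm (f z))\<^sup>2)"
    using f by (simp add: L2_circle_def)
  ultimately have "AE z in circle_measure. (norm (f z))\<^sup>2 = 0"
    by (subst (asm) integral_nonneg_eq_0_iff_AE) auto
  then show ?thesis by simp
qed

text \<open>
  The candidate \<open>F\<close> guarantees that the choice in \<open>pr_plus\<close> is made from a nonempty set; two
  solutions differ by a Hardy function orthogonal to itself.
\<close>
lemma pr_plus_eqI:
  assumes f: "f \<in> L2_circle" and F: "F \<in> H_plus"
    and orth: "\<And>h. h \<in> H_plus \<Longrightarrow> L2_inner (\<lambda>z. f z - F z) h = 0"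
  shows "pr_plus f \<in> H_plus" "AE z in circle_measure. pr_plus f z = F z"
proof -
  have G: "pr_plus f \<in> H_plus \<and> (\<forall>h\<in>H_plus. L2_inner (\<lambda>z. f z - pr_plus f z) h = 0)"
    unfolding pr_plus_def by (rule someI[where x=F]) (use F orth in blast)
  then show G1: "pr_plus f \<in> H_plus" by blast
  define d where "d = (\<lambda>z. pr_plus f z - F z)"
  have d: "d \<in> H_plus" unfolding d_def by (rule H_plus_diff[OF G1 F])
  \<comment> \<open>Orthogonality of both residuals to \<open>d\<close> itself forces \<open>d\<close> to vanish.\<close>
  have "L2_inner d d = L2_inner (\<lambda>z. (f z - F z) - (f z - pr_plus f z)) d"
    by (simp add: d_def)
  also have "\<dots> = L2_inner (\<lambda>z. f z - F z) d - L2_inner (\<lambda>z. f z - pr_plus f z) d"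
    by (intro L2_inner_diff_left L2_circle_diff f H_plus_L2 F G1 d)
  also have "\<dots> = 0" using orth[OF d] G d by simp
  finally have "AE z in circle_measure. d z = 0"
    by (rule L2_inner_self_zero[OF H_plus_L2[OF d]])
  then show "AE z in circle_measure. pr_plus f z = F z"
    by (simp add: d_def)
qed

lemma L2_inner_cong_AE:
  assumes "f \<in> borel_measurable circle_measure" "g \<in> borel_measurable circle_measure"
    "h \<in> borel_measurable circle_measure" "AE z in circle_measure. f z = g z"
  shows "L2_inner f h = L2_inner g h"
  unfolding L2_inner_def
proof (rule integral_cong_AE)
  note [measurable] = assms(1-3)[THEN measurable_vec_nth]
    assms(3)[THEN measurable_vec_nth, THEN measurable_cnj_circle]
  show "(\<lambda>z. \<Sum>i\<in>UNIV. f z $ i * cnj (h z $ i)) \<in> borel_measurable circle_measure"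
    "(\<lambda>z. \<Sum>i\<in>UNIV. g z $ i * cnj (h z $ i)) \<in> borel_measurable circle_measure"
    by measurable
  show "AE z in circle_measure. (\<Sum>i\<in>UNIV. f z $ i * cnj (h z $ i)) = (\<Sum>i\<in>UNIV. g z $ i * cnj (h z $ i))"
    using assms(4) by eventually_elim simp
qed

text \<open>
  The defining condition of the choice only involves integrals, so functions that agree almost
  everywhere receive literally the same representative.
\<close>
lemma pr_plus_cong_AE:
  assumes f: "f \<in> borel_measurable circle_measure" and g: "g \<in> borel_measurable circle_measure"
    and eq: "AE z in circle_measure. f z = g z"
  shows "pr_plus f = pr_plus g"
proof -
  have "L2_inner (\<lambda>z. f z - p z) h = L2_inner (\<lambda>z. g z - p z) h" if "p \<in> H_plus" "h \<in> H_plus" for p h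
    by (intro L2_inner_cong_AE borel_measurable_diff f g L2_circle_measurable H_plus_L2 that)
       (use eq in \<open>auto elim: AE_mp\<close>)
  then have "(\<lambda>p. p \<in> H_plus \<and> (\<forall>h\<in>H_plus. L2_inner (\<lambda>z. f z - p z) h = 0)) =
      (\<lambda>p. p \<in> H_plus \<and> (\<forall>h\<in>H_plus. L2_inner (\<lambda>z. g z - p z) h = 0))"
    by (auto simp: fun_eq_iff)
  then show ?thesis by (simp add: pr_plus_def)
qed

section \<open>Toeplitz operators of analytic matrix loops\<close>

definition matrix_commutator ::
    "(complex \<Rightarrow> complex ^ 'n ^ 'n) \<Rightarrow> (complex \<Rightarrow> complex ^ 'n) \<Rightarrow> complex \<Rightarrow> complex ^ 'n" where
  "matrix_commutator A u z =
     (\<chi> i. \<Sum>j\<in>UNIV. cauchy_commutator (\<lambda>z. A z $ i $ j) (\<lambda>z. u z $ j) z)"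

lemma square_integrable_sum:
  "finite I \<Longrightarrow> (\<And>i. i \<in> I \<Longrightarrow> square_integrable (f i)) \<Longrightarrow> square_integrable (\<lambda>z. \<Sum>i\<in>I. f i z)"
  by (induction I rule: finite_induct) (auto intro: square_integrable_add simp: square_integrable_const)

lemma hardy_sum:
  "finite I \<Longrightarrow> (\<And>i. i \<in> I \<Longrightarrow> hardy (f i)) \<Longrightarrow> hardy (\<lambda>z. \<Sum>i\<in>I. f i z)"
  by (induction I rule: finite_induct) (auto intro: hardy_add simp: hardy_const)

text \<open>
  Entrywise, the scalar result shows that \<open>A u + [C, A] u\<close> lies in $H_+$ and differs from \<open>A u\<close> by a
  function orthogonal to $H_+$. Exhibiting the projection in this form also proves that the choice
  in \<open>pr_plus\<close> succeeds for \<open>A u\<close>.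
\<close>
lemma
  fixes A :: "complex \<Rightarrow> complex ^ 'n ^ 'n"
  assumes A: "\<And>i j. circle_analytic (\<lambda>z. A z $ i $ j)" and u: "u \<in> H_plus"
  shows matrix_mult_L2_circle: "(\<lambda>z. A z *v u z) \<in> L2_circle"
    and matrix_mult_plus_commutator_in_H_plus: "(\<lambda>z. A z *v u z + matrix_commutator A u z) \<in> H_plus"
    and toeplitz_in_H_plus: "toeplitz A u \<in> H_plus"
    and toeplitz_eq: "AE z in circle_measure. toeplitz A u z = A z *v u z + matrix_commutator A u z"
proof -
  have u': "hardy (\<lambda>z. u z $ j)" for j using u by (simp add: H_plus_iff)
  show L2: "(\<lambda>z. A z *v u z) \<in> L2_circle"
    unfolding L2_circle_iff matrix_vector_mult_def vec_lambda_beta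
    by (intro allI square_integrable_sum square_integrable_circle_analytic_mult A hardyD(1)[OF u']) auto
  have K: "matrix_commutator A u \<in> L2_circle"
    unfolding L2_circle_iff matrix_commutator_def vec_lambda_beta
    by (intro allI square_integrable_sum square_integrable_cauchy_commutator A u') auto
  have "hardy (\<lambda>z. \<Sum>j\<in>UNIV. A z $ i $ j * u z $ j + cauchy_commutator (\<lambda>z. A z $ i $ j) (\<lambda>z. u z $ j) z)" for i
    by (intro hardy_sum hardy_cauchy_commutator A u') auto
  then show F: "(\<lambda>z. A z *v u z + matrix_commutator A u z) \<in> H_plus"
    by (simp add: H_plus_iff matrix_vector_mult_def matrix_commutator_def sum.distrib)
  have orth: "L2_inner (\<lambda>z. A z *v u z - (A z *v u z + matrix_commutator A u z)) h = 0"
    if h: "h \<in> H_plus" for h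
  proof -
    have int: "integrable circle_measure
        (\<lambda>z. cauchy_commutator (\<lambda>z. A z $ i $ j) (\<lambda>z. u z $ j) z * cnj (h z $ i))" for i j
      using h by (intro integrable_mult_square_integrable square_integrable_cauchy_commutator A u'
          square_integrable_cnj hardyD(1)) (simp add: H_plus_iff)
    have "L2_inner (matrix_commutator A u) h = (\<Sum>i\<in>UNIV. \<Sum>j\<in>UNIV. LINT z|circle_measure.
        cauchy_commutator (\<lambda>z. A z $ i $ j) (\<lambda>z. u z $ j) z * cnj (h z $ i))"
      unfolding L2_inner_eq_sum[OF K H_plus_L2[OF h]]
      by (simp add: matrix_commutator_def sum_distrib_right Bochner_Integration.integral_sum[OF int])
    also have "\<dots> = 0"
      using h by (intro sum.neutral ballI cauchy_commutator_orthogonal A u') (simp add: H_plus_iff)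
    finally have "L2_inner (matrix_commutator A u) h = 0" .
    moreover have "L2_inner (\<lambda>z. - matrix_commutator A u z) h = - L2_inner (matrix_commutator A u) h"
      by (simp add: L2_inner_def sum_negf)
    ultimately show ?thesis by simp
  qed
  show "toeplitz A u \<in> H_plus"
    "AE z in circle_measure. toeplitz A u z = A z *v u z + matrix_commutator A u z"
    unfolding toeplitz_def by (rule pr_plus_eqI[OF L2 F orth]; assumption)+
qed

section \<open>Analyticity of the inverse loop\<close>

lemma extends_analytically_imp_circle_analytic:
  assumes "extends_analytically \<gamma>" shows "circle_analytic (\<lambda>z. \<gamma> z $ i $ j)"
proof -
  obtain U \<Gamma> where "open U" "sphere 0 1 \<subseteq> U" "\<forall>i j. (\<lambda>z. \<Gamma> z $ i $ j) holomorphic_on U"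
    "\<forall>z\<in>sphere 0 1. \<Gamma> z = \<gamma> z"
    using assms unfolding extends_analytically_def by blast
  then show ?thesis
    unfolding circle_analytic_def by (intro exI[of _ U] exI[of _ "\<lambda>z. \<Gamma> z $ i $ j"]) auto
qed

lemma matrix_inv_inverse:
  fixes G :: "complex ^ 'n ^ 'n"
  assumes "invertible G"
  shows "G ** matrix_inv G = mat 1"
  using assms unfolding invertible_def matrix_inv_def by (rule someI2_ex) blast

text \<open>Cramer's rule shows that the inverse depends holomorphically on the entries.\<close>
lemma matrix_inv_nth:
  fixes G :: "complex ^ 'n ^ 'n"
  assumes "invertible G"
  shows "matrix_inv G $ k $ j = det (\<chi> i l. if l = k then axis j 1 $ i else G $ i $ l) / det G"
proof -
  have "G *v (matrix_inv G *v axis j 1) = axis j 1"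
    by (simp add: matrix_vector_mul_assoc matrix_inv_inverse[OF assms])
  then have "matrix_inv G *v axis j 1 =
      (\<chi> k. det (\<chi> i l. if l = k then axis j 1 $ i else G $ i $ l) / det G)"
    using cramer[of G] assms invertible_det_nz by blast
  moreover have "(matrix_inv G *v axis j 1) $ k = matrix_inv G $ k $ j"
    by (simp add: matrix_vector_mult_def axis_def if_distrib cong: if_cong)
  ultimately show ?thesis by simp
qed

lemma holomorphic_on_det:
  fixes G :: "complex \<Rightarrow> complex ^ 'n ^ 'n"
  assumes "\<And>i j. (\<lambda>z. G z $ i $ j) holomorphic_on U"
  shows "(\<lambda>z. det (G z)) holomorphic_on U"
  unfolding det_def by (intro holomorphic_intros assms)

lemma loop_inv_circle_analytic:
  fixes \<gamma> :: "complex \<Rightarrow> complex ^ 'n ^ 'n"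
  assumes inv: "\<And>z. z \<in> sphere 0 1 \<Longrightarrow> invertible (\<gamma> z)" and \<gamma>: "extends_analytically \<gamma>"
  shows "circle_analytic (\<lambda>z. loop_inv \<gamma> z $ k $ j)"
proof -
  obtain U \<Gamma> where U: "open U" "sphere 0 1 \<subseteq> U" and hol: "\<And>i j. (\<lambda>z. \<Gamma> z $ i $ j) holomorphic_on U"
    and eq: "\<And>z. z \<in> sphere 0 1 \<Longrightarrow> \<Gamma> z = \<gamma> z"
    using \<gamma> unfolding extends_analytically_def by blast
  have det: "(\<lambda>z. det (\<Gamma> z)) holomorphic_on U" by (rule holomorphic_on_det[OF hol])
  define V where "V = U \<inter> (\<lambda>z. det (\<Gamma> z)) -` (- {0})"
  have "open V"
    unfolding V_def by (rule continuous_open_preimage[OF holomorphic_on_imp_continuous_on[OF det] U(1)]) auto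
  moreover have "sphere 0 1 \<subseteq> V"
    using U(2) inv eq by (auto simp: V_def invertible_det_nz)
  moreover have "(\<lambda>z. det (\<chi> i l. if l = k then axis j 1 $ i else \<Gamma> z $ i $ l) / det (\<Gamma> z)) holomorphic_on V"
  proof (intro holomorphic_on_divide holomorphic_on_det)
    have "V \<subseteq> U" by (auto simp: V_def)
    then show "(\<lambda>z. (\<chi> i l. if l = k then axis j 1 $ i else \<Gamma> z $ i $ l) $ a $ b) holomorphic_on V" for a b
      using holomorphic_on_subset[OF hol] by (cases "b = k") auto
    show "(\<lambda>z. \<Gamma> z $ a $ b) holomorphic_on V" for a b
      by (rule holomorphic_on_subset[OF hol \<open>V \<subseteq> U\<close>])
  qed (auto simp: V_def)
  moreover have "det (\<chi> i l. if l = k then axis j 1 $ i else \<Gamma> z $ i $ l) / det (\<Gamma> z) = loop_inv \<gamma> z $ k $ j"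
    if "z \<in> sphere 0 1" for z
    unfolding loop_inv_def matrix_inv_nth[OF inv[OF that]] eq[OF that] ..
  ultimately show ?thesis
    unfolding circle_analytic_def by blast
qed

section \<open>The two operators agree\<close>

text \<open>
  Inserting \<open>I = \<gamma>(z) \<gamma>\<inverse>(z)\<close> in the kernel pulls \<open>\<gamma>(z)\<close> out of the contour integral and leaves the
  commutator with \<open>\<gamma>\<inverse>\<close>. The identity holds at every point of the circle.
\<close>
lemma P_tilde_integrand:
  fixes \<gamma> :: "complex \<Rightarrow> complex ^ 'n ^ 'n"
  assumes inv: "\<And>z. z \<in> sphere 0 1 \<Longrightarrow> invertible (\<gamma> z)" and \<gamma>: "extends_analytically \<gamma>"
    and \<psi>: "\<psi> \<in> H_plus" and z: "z \<in> sphere 0 1"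
  shows "\<psi> z + (1 / (2 * complex_of_real pi * \<i>)) *s
     (\<chi> i. contour_integral (circlepath 0 1)
             (\<lambda>\<zeta>. ((\<gamma> z ** loop_inv \<gamma> \<zeta> - mat 1) *v \<psi> \<zeta>) $ i / (\<zeta> - z))) =
    \<gamma> z *v (loop_inv \<gamma> z *v \<psi> z + matrix_commutator (loop_inv \<gamma>) \<psi> z)"
proof -
  define B where "B = loop_inv \<gamma>"
  have B: "circle_analytic (\<lambda>z. B z $ k $ j)" for k j
    unfolding B_def by (rule loop_inv_circle_analytic[OF inv \<gamma>])
  have \<psi>': "hardy (\<lambda>z. \<psi> z $ j)" for j using \<psi> by (simp add: H_plus_iff)
  have \<gamma>B: "\<gamma> z ** B z = mat 1"
    unfolding B_def loop_inv_def by (rule matrix_inv_inverse[OF inv[OF z]])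
  have int: "integrable circle_measure (\<lambda>\<zeta>. \<zeta> * (diff_quotient (\<lambda>z. B z $ k $ j) z \<zeta> * \<psi> \<zeta> $ j))" for k j
    by (rule integrable_cauchy_commutator[OF B \<psi>' z])
  define f where "f = (\<lambda>i \<zeta>. ((\<gamma> z ** B \<zeta> - mat 1) *v \<psi> \<zeta>) $ i / (\<zeta> - z))"
  have f: "\<zeta> * f i \<zeta> =
      (\<Sum>k\<in>UNIV. \<gamma> z $ i $ k * (\<Sum>j\<in>UNIV. \<zeta> * (diff_quotient (\<lambda>z. B z $ k $ j) z \<zeta> * \<psi> \<zeta> $ j)))" for i \<zeta>
  proof -
    have "(\<gamma> z ** B \<zeta> - mat 1) *v \<psi> \<zeta> = \<gamma> z *v ((B \<zeta> - B z) *v \<psi> \<zeta>)"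
      by (simp add: \<gamma>B[symmetric] matrix_vector_mul_assoc matrix_vector_mult_diff_rdistrib
          matrix_vector_mult_diff_distrib)
    then have entry: "((\<gamma> z ** B \<zeta> - mat 1) *v \<psi> \<zeta>) $ i =
        (\<Sum>k\<in>UNIV. \<gamma> z $ i $ k * (\<Sum>j\<in>UNIV. (B \<zeta> $ k $ j - B z $ k $ j) * \<psi> \<zeta> $ j))"
      by (simp only: matrix_vector_mult_def vec_lambda_beta vector_minus_component)
    show ?thesis
      unfolding f_def entry diff_quotient_def
      by (simp add: sum_divide_distrib sum_distrib_left mult_ac)
  qed
  have "contour_integral (circlepath 0 1) (f i) = 2 * complex_of_real pi * \<i> *
      (\<gamma> z *v matrix_commutator B \<psi> z) $ i" for i
  proof -
    have "integrable circle_measure (\<lambda>\<zeta>. \<zeta> * f i \<zeta>)"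
      unfolding f by (intro Bochner_Integration.integrable_sum integrable_mult_right int)
    then have "contour_integral (circlepath 0 1) (f i) =
        2 * complex_of_real pi * \<i> * (LINT \<zeta>|circle_measure. \<zeta> * f i \<zeta>)"
      by (intro contour_integral_unique has_contour_integral_circle)
    also have "(LINT \<zeta>|circle_measure. \<zeta> * f i \<zeta>) = (\<Sum>k\<in>UNIV. \<gamma> z $ i $ k * (\<Sum>j\<in>UNIV.
        LINT \<zeta>|circle_measure. \<zeta> * (diff_quotient (\<lambda>z. B z $ k $ j) z \<zeta> * \<psi> \<zeta> $ j)))"
      unfolding f
      by (subst Bochner_Integration.integral_sum)
         (auto simp: Bochner_Integration.integral_sum[OF int] int)
    also have "\<dots> = (\<gamma> z *v matrix_commutator B \<psi> z) $ i"
      by (simp add: matrix_vector_mult_def matrix_commutator_def cauchy_commutator_def)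
    finally show ?thesis .
  qed
  then have "(1 / (2 * complex_of_real pi * \<i>)) *s (\<chi> i. contour_integral (circlepath 0 1) (f i)) =
      \<gamma> z *v matrix_commutator B \<psi> z"
    by (simp add: vec_eq_iff)
  moreover have "\<psi> z = \<gamma> z *v (B z *v \<psi> z)"
    by (simp add: matrix_vector_mul_assoc \<gamma>B)
  ultimately show ?thesis
    unfolding B_def[symmetric] f_def by (simp add: matrix_vector_right_distrib)
qed

theorem proposition4p4:
  fixes \<gamma> :: "complex \<Rightarrow> complex ^ 'n ^ 'n"
  assumes "\<And>z. z \<in> sphere 0 1 \<Longrightarrow> invertible (\<gamma> z)"
    and "extends_analytically \<gamma>"
  shows "operator_eq_H_plus (P_tilde \<gamma>) (P_op \<gamma>)"
  unfolding operator_eq_H_plus_def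
proof (intro ballI)
  fix \<psi> :: "complex \<Rightarrow> complex ^ 'n" assume \<psi>: "\<psi> \<in> H_plus"
  define B where "B = loop_inv \<gamma>"
  define G where "G = toeplitz B \<psi>"
  have \<gamma>: "circle_analytic (\<lambda>z. \<gamma> z $ i $ j)" and B: "circle_analytic (\<lambda>z. B z $ i $ j)" for i j
    unfolding B_def
    by (rule extends_analytically_imp_circle_analytic[OF assms(2)] loop_inv_circle_analytic[OF assms])+
  have G: "G \<in> H_plus" "AE z in circle_measure. G z = B z *v \<psi> z + matrix_commutator B \<psi> z"
    unfolding G_def by (rule toeplitz_in_H_plus[OF B \<psi>] toeplitz_eq[OF B \<psi>])+
  define F where "F = (\<lambda>z. B z *v \<psi> z + matrix_commutator B \<psi> z)"
  have F: "F \<in> H_plus"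
    unfolding F_def by (rule matrix_mult_plus_commutator_in_H_plus[OF B \<psi>])
  define I where "I = (\<lambda>z. \<psi> z + (1 / (2 * complex_of_real pi * \<i>)) *s
     (\<chi> i. contour_integral (circlepath 0 1)
             (\<lambda>\<zeta>. ((\<gamma> z ** loop_inv \<gamma> \<zeta> - mat 1) *v \<psi> \<zeta>) $ i / (\<zeta> - z))))"
  \<comment> \<open>Being pointwise, this also shows that \<open>I\<close> is measurable.\<close>
  have I: "I z = \<gamma> z *v F z" if "z \<in> sphere 0 1" for z
    unfolding I_def F_def B_def by (rule P_tilde_integrand[OF assms \<psi> that])
  have meas: "(\<lambda>z. \<gamma> z *v H z) \<in> borel_measurable circle_measure" if "H \<in> H_plus" for H
    by (rule L2_circle_measurable[OF matrix_mult_L2_circle[OF \<gamma> that]])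
  have "P_tilde \<gamma> \<psi> = pr_plus I"
    by (simp add: P_tilde_def I_def)
  also have "\<dots> = pr_plus (\<lambda>z. \<gamma> z *v G z)"
  proof (rule pr_plus_cong_AE)
    show "I \<in> borel_measurable circle_measure"
      using meas[OF F] by (subst measurable_cong) (auto simp: I)
    show "(\<lambda>z. \<gamma> z *v G z) \<in> borel_measurable circle_measure"
      by (rule meas[OF G(1)])
    show "AE z in circle_measure. I z = \<gamma> z *v G z"
      using G(2) AE_space by eventually_elim (simp add: I F_def)
  qed
  also have "\<dots> = P_op \<gamma> \<psi>"
    by (simp add: P_op_def toeplitz_def[of \<gamma>] G_def B_def)
  finally have eq: "P_tilde \<gamma> \<psi> = P_op \<gamma> \<psi>" .
  moreover have "P_op \<gamma> \<psi> \<in> H_plus"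
    using toeplitz_in_H_plus[OF \<gamma> G(1)] by (simp add: P_op_def G_def B_def)
  ultimately show "P_tilde \<gamma> \<psi> \<in> H_plus \<and> P_op \<gamma> \<psi> \<in> H_plus \<and>
      (AE z in circle_measure. P_tilde \<gamma> \<psi> z = P_op \<gamma> \<psi> z)"
    by simp
qed

end
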